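(* Let $\mathbf{x}:U\to\mathbb{R}^3$ be a proper wavefront, $\Omega$ a tangent moving basis of $\mathbf{x}$, $\mathbf{p}\in\Sigma(\mathbf{x})$ with $\mathrm{rank}(D\mathbf{x}(\mathbf{p}))=0$, and let $W\subset U$ be a compact neighborhood of $\mathbf{p}$ on which $K_\Omega\neq0$. The following statements are equivalent: (1) The mean curvature $H$ is bounded on $W\setminus\Sigma(\mathbf{x})$. (2) There exists $C>0$ such that $|H_\Omega|\le C|\lambda_\Omega|$ on $W$. (3) There exists $C>0$ such that $|eG+gE-2fF|\le C|\lambda_\Omega^2|$ on $W$. (4) There exists $C>0$ such that $\left|\frac1{k_1}+\frac1{k_2}\right|\le C|\lambda_\Omega|$ on $W$ (where $\frac1{k_1}+\frac1{k_2}$ denotes the $C^\infty$ extension to $W$ of this function). (5) $\frac1{k_{1\Omega}}+\frac1{k_{2\Omega}}$ is bounded on $W\setminus\Sigma(\mathbf{x})$.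
   Context: All maps are $C^\infty$; $U\subset\mathbb{R}^2$ is open, with coordinates $(u,v)$. A smooth map $\mathbf{x}:U\to\mathbb{R}^3$ is a frontal if every $\mathbf{p}\in U$ has an open neighborhood $V_p\subset U$ with a smooth unit vector field $\mathbf{n}_p:V_p\to\mathbb{R}^3$ orthogonal to $\mathbf{x}_u,\mathbf{x}_v$; it is a wavefront (front) if moreover each $(\mathbf{x},\mathbf{n}_p)$ is an immersion into $\mathbb{R}^3\times S^2$. The singular set is $\Sigma(\mathbf{x})=\{\mathbf{p}\in U:\mathbf{x}\text{ is not immersive at }\mathbf{p}\}$; $\mathbf{x}$ is proper if $\Sigma(\mathbf{x})$ has empty interior. A tangent moving basis (tmb) of $\mathbf{x}$ is a smooth map $\Omega=(\mathbf{w}_1\ \mathbf{w}_2):U\to\mathcal{M}_{3\times2}(\mathbb{R})$ with linearly independent columns at each point and $\mathbf{x}_u,\mathbf{x}_v\in\mathrm{span}(\mathbf{w}_1,\mathbf{w}_2)$. Put $\mathbf{n}=\frac{\mathbf{w}_1\times\mathbf{w}_2}{\|\mathbf{w}_1\times\mathbf{w}_2\|}$, $\mathbf{I}_\Omega=\Omega^T\Omega$, $\mathbf{II}_\Omega=-\Omega^TD\mathbf{n}$, $\mu_\Omega=-\mathbf{II}_\Omega^T\mathbf{I}_\Omega^{-1}$, $\Lambda_\Omega=D\mathbf{x}^T\Omega\,\mathbf{I}_\Omega^{-1}$, $\lambda_\Omega=\det\Lambda_\Omega$, $K_\Omega=\det\mu_\Omega$, $H_\Omega=-\frac12\mathrm{tr}(\mu_\Omega\,\mathrm{adj}(\Lambda_\Omega))$.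 One has $D\mathbf{x}=\Omega\Lambda_\Omega^T$ and $D\mathbf{n}=\Omega\mu_\Omega^T$, so $\Sigma(\mathbf{x})=\lambda_\Omega^{-1}(0)$. The fundamental forms are $\begin{pmatrix} E & F \\ F & G \end{pmatrix}=D\mathbf{x}^TD\mathbf{x}$ and $\begin{pmatrix} e & f \\ f & g \end{pmatrix}=-D\mathbf{x}^TD\mathbf{n}$ on $U$; on $U\setminus\Sigma(\mathbf{x})$, $K=\frac{eg-f^2}{EG-F^2}$ and $H=\frac{eG+gE-2fF}{2(EG-F^2)}$ are the Gaussian and mean curvatures. The relative principal curvatures are $k_{1\Omega}=H_\Omega-\sqrt{H_\Omega^2-\lambda_\Omega K_\Omega}$ and $k_{2\Omega}=H_\Omega+\sqrt{H_\Omega^2-\lambda_\Omega K_\Omega}$ on $U$. On $U\setminus\Sigma(\mathbf{x})$: $k_1=H-\sqrt{H^2-K}$ and $k_2=H+\sqrt{H^2-K}$ where $\lambda_\Omega>0$; $k_1=H+\sqrt{H^2-K}$ and $k_2=H-\sqrt{H^2-K}$ where $\lambda_\Omega<0$. Where $K_\Omega\ne0$, $k_1,k_2$ are nonzero off $\Sigma(\mathbf{x})$ and $\frac1{k_1}+\frac1{k_2}=\frac{2H_\Omega}{K_\Omega}$ there; the right-hand side is the $C^\infty$ extension across $\Sigma(\mathbf{x})$.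
   Formalization: The compact neighborhood W is additionally required to equal the closure of its interior; for an arbitrary compact neighborhood the equivalence can fail, e.g. when W is a disc about p plus an isolated singular point where the mean-curvature numerator H_Ω is nonzero. *)

theory Defs
  imports "HOL-Analysis.Analysis"
begin

primrec times_differentiable_on ::
    "nat \<Rightarrow> ('a::real_normed_vector \<Rightarrow> 'b::real_normed_vector) \<Rightarrow> 'a set \<Rightarrow> bool" where
  "times_differentiable_on 0 f S \<longleftrightarrow> continuous_on S f"
| "times_differentiable_on (Suc k) f S \<longleftrightarrow>
     (\<forall>q\<in>S. f differentiable (at q)) \<and>
     (\<forall>v. times_differentiable_on k (\<lambda>q. frechet_derivative f (at q) v) S)"

text \<open>The derivatives are full derivatives \<open>at q\<close>, so this notion is meant for open sets only.\<close>

definition smooth_on :: "'a::real_normed_vector set \<Rightarrow> ('a \<Rightarrow> 'b::real_normed_vector) \<Rightarrow> bool" where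
  "smooth_on S f \<longleftrightarrow> (\<forall>k. times_differentiable_on k f S)"

definition immersive_at :: "('a::real_normed_vector \<Rightarrow> 'b::real_normed_vector) \<Rightarrow> 'a \<Rightarrow> bool" where
  "immersive_at f q \<longleftrightarrow> f differentiable (at q) \<and> inj (frechet_derivative f (at q))"

text \<open>
  The coordinates \<open>(u, v)\<close> of a point \<open>q :: real^2\<close> are \<open>(q$1, q$2)\<close>. A \<open>3 \<times> 2\<close> matrix has type
  \<open>real^2^3\<close>, and the columns of \<open>Df x q\<close> are the partial derivatives of \<open>x\<close> with respect to
  \<open>u\<close> and \<open>v\<close>.
\<close>

abbreviation Df :: "(real^2 \<Rightarrow> real^3) \<Rightarrow> real^2 \<Rightarrow> real^2^3" where
  "Df x q \<equiv> jacobian x (at q)"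

definition unit_normal_on :: "(real^2) set \<Rightarrow> (real^2 \<Rightarrow> real^3) \<Rightarrow> (real^2 \<Rightarrow> real^3) \<Rightarrow> bool" where
  "unit_normal_on V x n \<longleftrightarrow> smooth_on V n \<and>
     (\<forall>q\<in>V. norm (n q) = 1 \<and> orthogonal (n q) (column 1 (Df x q))
                            \<and> orthogonal (n q) (column 2 (Df x q)))"

definition frontal :: "(real^2) set \<Rightarrow> (real^2 \<Rightarrow> real^3) \<Rightarrow> bool" where
  "frontal U x \<longleftrightarrow> smooth_on U x \<and>
     (\<forall>p\<in>U. \<exists>V n. open V \<and> p \<in> V \<and> V \<subseteq> U \<and> unit_normal_on V x n)"

text \<open>
  Since \<open>n\<close> takes values in the unit sphere, an embedded submanifold of \<open>real^3\<close>, the pair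
  \<open>(x, n)\<close> is an immersion into the product with the sphere iff it is one into
  \<open>real^3 \<times> real^3\<close>.
\<close>

definition wavefront :: "(real^2) set \<Rightarrow> (real^2 \<Rightarrow> real^3) \<Rightarrow> bool" where
  "wavefront U x \<longleftrightarrow> frontal U x \<and>
     (\<forall>p\<in>U. \<exists>V n. open V \<and> p \<in> V \<and> V \<subseteq> U \<and> unit_normal_on V x n \<and>
                    (\<forall>q\<in>V. immersive_at (\<lambda>r. (x r, n r)) q))"

definition singular_set :: "(real^2) set \<Rightarrow> (real^2 \<Rightarrow> real^3) \<Rightarrow> (real^2) set" where
  "singular_set U x = {q\<in>U. \<not> immersive_at x q}"

definition proper :: "(real^2) set \<Rightarrow> (real^2 \<Rightarrow> real^3) \<Rightarrow> bool" where
  "proper U x \<longleftrightarrow> interior (singular_set U x) = {}"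

text \<open>
  Distinctness of the columns has to be required separately: \<open>independent\<close> is a property of sets,
  and two equal nonzero columns form an independent singleton.
\<close>

definition tangent_moving_basis ::
    "(real^2) set \<Rightarrow> (real^2 \<Rightarrow> real^3) \<Rightarrow> (real^2 \<Rightarrow> real^2^3) \<Rightarrow> bool" where
  "tangent_moving_basis U x \<Omega> \<longleftrightarrow> smooth_on U \<Omega> \<and>
     (\<forall>q\<in>U. let w1 = column 1 (\<Omega> q); w2 = column 2 (\<Omega> q) in
        w1 \<noteq> w2 \<and> independent {w1, w2} \<and>
        column 1 (Df x q) \<in> span {w1, w2} \<and> column 2 (Df x q) \<in> span {w1, w2})"

definition adj2 :: "real^2^2 \<Rightarrow> real^2^2" where
  "adj2 A = vector [vector [A$2$2, - A$1$2], vector [- A$2$1, A$1$1]]"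

definition normal :: "(real^2 \<Rightarrow> real^2^3) \<Rightarrow> real^2 \<Rightarrow> real^3" where
  "normal \<Omega> q = (let c = cross3 (column 1 (\<Omega> q)) (column 2 (\<Omega> q)) in c /\<^sub>R norm c)"

definition I_rel :: "(real^2 \<Rightarrow> real^2^3) \<Rightarrow> real^2 \<Rightarrow> real^2^2" where
  "I_rel \<Omega> q = transpose (\<Omega> q) ** \<Omega> q"

definition II_rel :: "(real^2 \<Rightarrow> real^2^3) \<Rightarrow> real^2 \<Rightarrow> real^2^2" where
  "II_rel \<Omega> q = - (transpose (\<Omega> q) ** Df (normal \<Omega>) q)"

definition mu_rel :: "(real^2 \<Rightarrow> real^2^3) \<Rightarrow> real^2 \<Rightarrow> real^2^2" where
  "mu_rel \<Omega> q = - (transpose (II_rel \<Omega> q) ** matrix_inv (I_rel \<Omega> q))"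

definition Lambda_rel :: "(real^2 \<Rightarrow> real^3) \<Rightarrow> (real^2 \<Rightarrow> real^2^3) \<Rightarrow> real^2 \<Rightarrow> real^2^2" where
  "Lambda_rel x \<Omega> q = transpose (Df x q) ** \<Omega> q ** matrix_inv (I_rel \<Omega> q)"

definition lambda_rel :: "(real^2 \<Rightarrow> real^3) \<Rightarrow> (real^2 \<Rightarrow> real^2^3) \<Rightarrow> real^2 \<Rightarrow> real" where
  "lambda_rel x \<Omega> q = det (Lambda_rel x \<Omega> q)"

definition K_rel :: "(real^2 \<Rightarrow> real^2^3) \<Rightarrow> real^2 \<Rightarrow> real" where
  "K_rel \<Omega> q = det (mu_rel \<Omega> q)"

definition H_rel :: "(real^2 \<Rightarrow> real^3) \<Rightarrow> (real^2 \<Rightarrow> real^2^3) \<Rightarrow> real^2 \<Rightarrow> real" where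
  "H_rel x \<Omega> q = - (1/2) * trace (mu_rel \<Omega> q ** adj2 (Lambda_rel x \<Omega> q))"

definition k1_rel :: "(real^2 \<Rightarrow> real^3) \<Rightarrow> (real^2 \<Rightarrow> real^2^3) \<Rightarrow> real^2 \<Rightarrow> real" where
  "k1_rel x \<Omega> q = H_rel x \<Omega> q - sqrt ((H_rel x \<Omega> q)\<^sup>2 - lambda_rel x \<Omega> q * K_rel \<Omega> q)"

definition k2_rel :: "(real^2 \<Rightarrow> real^3) \<Rightarrow> (real^2 \<Rightarrow> real^2^3) \<Rightarrow> real^2 \<Rightarrow> real" where
  "k2_rel x \<Omega> q = H_rel x \<Omega> q + sqrt ((H_rel x \<Omega> q)\<^sup>2 - lambda_rel x \<Omega> q * K_rel \<Omega> q)"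

definition form1 :: "(real^2 \<Rightarrow> real^3) \<Rightarrow> real^2 \<Rightarrow> real^2^2" where
  "form1 x q = transpose (Df x q) ** Df x q"

definition form2 :: "(real^2 \<Rightarrow> real^3) \<Rightarrow> (real^2 \<Rightarrow> real^2^3) \<Rightarrow> real^2 \<Rightarrow> real^2^2" where
  "form2 x \<Omega> q = - (transpose (Df x q) ** Df (normal \<Omega>) q)"

definition "coeff_E x q = form1 x q $ 1 $ 1"
definition "coeff_F x q = form1 x q $ 1 $ 2"
definition "coeff_G x q = form1 x q $ 2 $ 2"

text \<open>
  By symmetry of the second derivatives of \<open>x\<close>, the matrix \<open>form2 x \<Omega> q\<close> is symmetric whenever
  \<open>\<Omega>\<close> is a tangent moving basis of \<open>x\<close>, so either off-diagonal entry can serve as \<open>f\<close>.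
\<close>

definition "coeff_e x \<Omega> q = form2 x \<Omega> q $ 1 $ 1"
definition "coeff_f x \<Omega> q = form2 x \<Omega> q $ 1 $ 2"
definition "coeff_g x \<Omega> q = form2 x \<Omega> q $ 2 $ 2"

text \<open>\<open>K\<close>, \<open>H\<close>, \<open>k1\<close> and \<open>k2\<close> are meaningful only off the singular set.\<close>

definition gauss_K :: "(real^2 \<Rightarrow> real^3) \<Rightarrow> (real^2 \<Rightarrow> real^2^3) \<Rightarrow> real^2 \<Rightarrow> real" where
  "gauss_K x \<Omega> q = (coeff_e x \<Omega> q * coeff_g x \<Omega> q - (coeff_f x \<Omega> q)\<^sup>2) /
                   (coeff_E x q * coeff_G x q - (coeff_F x q)\<^sup>2)"

definition mean_H :: "(real^2 \<Rightarrow> real^3) \<Rightarrow> (real^2 \<Rightarrow> real^2^3) \<Rightarrow> real^2 \<Rightarrow> real" where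
  "mean_H x \<Omega> q =
     (coeff_e x \<Omega> q * coeff_G x q + coeff_g x \<Omega> q * coeff_E x q - 2 * coeff_f x \<Omega> q * coeff_F x q) /
     (2 * (coeff_E x q * coeff_G x q - (coeff_F x q)\<^sup>2))"

definition k1 :: "(real^2 \<Rightarrow> real^3) \<Rightarrow> (real^2 \<Rightarrow> real^2^3) \<Rightarrow> real^2 \<Rightarrow> real" where
  "k1 x \<Omega> q = (if lambda_rel x \<Omega> q > 0
     then mean_H x \<Omega> q - sqrt ((mean_H x \<Omega> q)\<^sup>2 - gauss_K x \<Omega> q)
     else mean_H x \<Omega> q + sqrt ((mean_H x \<Omega> q)\<^sup>2 - gauss_K x \<Omega> q))"

definition k2 :: "(real^2 \<Rightarrow> real^3) \<Rightarrow> (real^2 \<Rightarrow> real^2^3) \<Rightarrow> real^2 \<Rightarrow> real" where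
  "k2 x \<Omega> q = (if lambda_rel x \<Omega> q > 0
     then mean_H x \<Omega> q + sqrt ((mean_H x \<Omega> q)\<^sup>2 - gauss_K x \<Omega> q)
     else mean_H x \<Omega> q - sqrt ((mean_H x \<Omega> q)\<^sup>2 - gauss_K x \<Omega> q))"

text \<open>
  The smooth extension of \<open>1/k1 + 1/k2\<close> across the singular set, on the open set where
  \<open>K_rel\<close> does not vanish. For a proper frontal such an extension exists (it is
  \<open>2 * H_rel / K_rel\<close>), and its values on that set are uniquely determined, because the
  nonsingular points are dense.
\<close>

definition recip_sum_ext ::
    "(real^2) set \<Rightarrow> (real^2 \<Rightarrow> real^3) \<Rightarrow> (real^2 \<Rightarrow> real^2^3) \<Rightarrow> real^2 \<Rightarrow> real" where
  "recip_sum_ext U x \<Omega> =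
     (SOME \<phi>. smooth_on {q\<in>U. K_rel \<Omega> q \<noteq> 0} \<phi> \<and>
        (\<forall>q\<in>{q\<in>U. K_rel \<Omega> q \<noteq> 0} - singular_set U x. \<phi> q = 1 / k1 x \<Omega> q + 1 / k2 x \<Omega> q))"

text \<open>
  A compact neighbourhood is the compact closure of an open neighbourhood. The clause
  \<open>closure (interior W) = W\<close> keeps out stray points of \<open>W\<close> that lie in the singular set but not in
  the closure of the nonsingular part of \<open>W\<close>; boundedness on the latter says nothing about
  such points.
\<close>

definition compact_nbhd :: "'a::topological_space \<Rightarrow> 'a set \<Rightarrow> bool" where
  "compact_nbhd p W \<longleftrightarrow> compact W \<and> p \<in> interior W \<and> closure (interior W) = W"

end

theory Submission
  imports Defs
begin

text \<open>
  Write \<open>h\<close>, \<open>l\<close>, \<open>k\<close> for the relative quantities \<open>H_rel\<close>, \<open>lambda_rel\<close>, \<open>K_rel\<close> and \<open>d\<close> for the positive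
  function \<open>det (I_rel \<Omega>)\<close>. From \<open>Df x = \<Omega> ** transpose Lambda\<close> the fundamental forms factor through
  \<open>I_rel\<close>, and \<open>2 \<times> 2\<close> algebra gives \<open>eG + gE - 2fF = 2 l d h\<close>, \<open>EG - F\<^sup>2 = l\<^sup>2 d\<close>, \<open>eg - f\<^sup>2 = l d k\<close>.
  Hence, off the singular set, \<open>H = h / l\<close>, \<open>K = k / l\<close>, \<open>1/k1 + 1/k2 = 2 h / k\<close> and
  \<open>1/k1_rel + 1/k2_rel = 2 h / (l k)\<close>. Since \<open>d\<close> and \<open>k\<close> are bounded away from \<open>0\<close> and \<open>\<infinity>\<close> on the compact
  set \<open>W\<close>, each of the five statements says that \<open>h\<close> is dominated by \<open>l\<close>, either on \<open>W\<close> or on its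
  nonsingular part; these agree because the nonsingular part is dense in \<open>W\<close> and everything is
  continuous.
\<close>

subsection \<open>Smooth functions\<close>

text \<open>Openness of \<open>S\<close> makes \<open>f\<close> and \<open>g\<close> agree near each
  of its points, so their full derivatives agree on \<open>S\<close> and the induction passes to
  those derivatives.\<close>

lemma times_differentiable_on_cong:
  assumes "open S" and "\<And>q. q \<in> S \<Longrightarrow> f q = g q"
  shows "times_differentiable_on k f S \<longleftrightarrow> times_differentiable_on k g S"
  using assms
proof (induction k arbitrary: f g)
  case 0
  then show ?case by (simp cong: continuous_on_cong)
next
  case (Suc k)
  have *: "times_differentiable_on (Suc k) f S"
    if g: "times_differentiable_on (Suc k) g S" and eq: "\<And>q. q \<in> S \<Longrightarrow> f q = g q" for f g :: "'a \<Rightarrow> 'b"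
  proof -
    have df: "f differentiable (at q)" if "q \<in> S" for q
    proof -
      have "(g has_derivative frechet_derivative g (at q)) (at q)"
        using g that by (simp add: frechet_derivative_works)
      then have "(f has_derivative frechet_derivative g (at q)) (at q)"
        by (rule has_derivative_transform_within_open[OF _ \<open>open S\<close> that]) (simp add: eq)
      then show ?thesis by (auto simp: differentiable_def)
    qed
    have "frechet_derivative f (at q) = frechet_derivative g (at q)" if "q \<in> S" for q
      using frechet_derivative_transform_within_open[OF df \<open>open S\<close>] that eq by blast
    then have "times_differentiable_on k (\<lambda>q. frechet_derivative f (at q) v) S" for v
      using Suc.IH[OF \<open>open S\<close>, of "\<lambda>q. frechet_derivative f (at q) v" "\<lambda>q. frechet_derivative g (at q) v"] g
      by simp
    then show ?thesis using df by simp
  qed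
  show ?case
    using *[of g f, OF _ Suc.prems(2)] *[of f g, OF _ Suc.prems(2)[symmetric]] by blast
qed

text \<open>Introduction rule for an explicitly given derivative \<open>D\<close>: by uniqueness it
  is the chosen \<open>frechet_derivative\<close> on \<open>S\<close>, and the congruence lemma
  exchanges the two. The closure rules below differentiate once by a known formula and then apply
  the induction hypothesis to its ingredients.\<close>

lemma times_differentiable_on_SucI:
  assumes "open S" and "\<And>q. q \<in> S \<Longrightarrow> (f has_derivative D q) (at q)"
    and "\<And>v. times_differentiable_on k (\<lambda>q. D q v) S"
  shows "times_differentiable_on (Suc k) f S"
proof -
  have "frechet_derivative f (at q) = D q" if "q \<in> S" for q
    using frechet_derivative_at[OF assms(2)[OF that]] by simp
  then have "times_differentiable_on k (\<lambda>q. frechet_derivative f (at q) v) S" for v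
    using assms(3)[of v] times_differentiable_on_cong[OF \<open>open S\<close>, of "\<lambda>q. frechet_derivative f (at q) v" "\<lambda>q. D q v"]
    by simp
  then show ?thesis using assms(2) unfolding differentiable_def times_differentiable_on.simps by blast
qed

lemma times_differentiable_on_Suc_has_derivative:
  "times_differentiable_on (Suc k) f S \<Longrightarrow> q \<in> S \<Longrightarrow>
     (f has_derivative frechet_derivative f (at q)) (at q)"
  by (simp add: frechet_derivative_works)

lemma times_differentiable_on_SucD:
  "times_differentiable_on (Suc k) f S \<Longrightarrow> times_differentiable_on k f S"
proof (induction k arbitrary: f)
  case 0
  then show ?case
    by (simp add: differentiable_imp_continuous_within continuous_at_imp_continuous_on)
next
  case (Suc k)
  have "times_differentiable_on k (\<lambda>q. frechet_derivative f (at q) v) S" for v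
    by (rule Suc.IH) (use Suc.prems in simp)
  then show ?case using Suc.prems by simp
qed

lemma times_differentiable_on_const: "times_differentiable_on k (\<lambda>q. c) S"
  by (induction k arbitrary: c) auto

lemma times_differentiable_on_linear:
  assumes "open S" "bounded_linear h" "times_differentiable_on k f S"
  shows "times_differentiable_on k (\<lambda>q. h (f q)) S"
  using assms(3)
proof (induction k arbitrary: f)
  case 0
  then show ?case using assms by (simp add: bounded_linear.continuous_on)
next
  case (Suc k)
  show ?case
    by (rule times_differentiable_on_SucI[OF \<open>open S\<close>
        bounded_linear.has_derivative[OF assms(2) times_differentiable_on_Suc_has_derivative[OF Suc.prems]]])
      (use Suc in auto)
qed

lemma times_differentiable_on_add:
  assumes "open S" "times_differentiable_on k f S" "times_differentiable_on k g S"
  shows "times_differentiable_on k (\<lambda>q. f q + g q) S"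
  using assms(2,3)
proof (induction k arbitrary: f g)
  case 0
  then show ?case by (simp add: continuous_on_add)
next
  case (Suc k)
  show ?case
    by (rule times_differentiable_on_SucI[OF \<open>open S\<close>
        has_derivative_add[OF times_differentiable_on_Suc_has_derivative[OF Suc.prems(1)]
          times_differentiable_on_Suc_has_derivative[OF Suc.prems(2)]]])
      (use Suc in auto)
qed

text \<open>The product rule gives a sum of two bilinear terms, each with one differentiated and one
  undifferentiated factor. The undifferentiated factor has one order to spare, which
  \<open>times_differentiable_on_SucD\<close> gives away.\<close>

lemma times_differentiable_on_bilinear:
  assumes "bounded_bilinear b" "open S" "times_differentiable_on k f S" "times_differentiable_on k g S"
  shows "times_differentiable_on k (\<lambda>q. b (f q) (g q)) S"
  using assms(3,4)
proof (induction k arbitrary: f g)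
  case 0
  then show ?case using assms(1) by (simp add: bounded_bilinear.continuous_on)
next
  case (Suc k)
  show ?case
    by (rule times_differentiable_on_SucI[OF \<open>open S\<close>
        bounded_bilinear.FDERIV[OF assms(1) times_differentiable_on_Suc_has_derivative[OF Suc.prems(1)]
          times_differentiable_on_Suc_has_derivative[OF Suc.prems(2)]]])
      (use Suc times_differentiable_on_SucD[OF Suc.prems(1)] times_differentiable_on_SucD[OF Suc.prems(2)] in
       \<open>auto intro!: times_differentiable_on_add[OF \<open>open S\<close>]\<close>)
qed

text \<open>A bootstrap: the derivative of \<open>1/f\<close> is a product of \<open>f'\<close> and
  two copies of \<open>1/f\<close>, and the induction hypothesis supplies \<open>1/f\<close> at the
  lower order.\<close>

lemma times_differentiable_on_inverse:
  fixes f :: "'a::real_normed_vector \<Rightarrow> real"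
  assumes "open S" "times_differentiable_on k f S" "\<And>q. q \<in> S \<Longrightarrow> f q \<noteq> 0"
  shows "times_differentiable_on k (\<lambda>q. inverse (f q)) S"
  using assms(2)
proof (induction k)
  case 0
  then show ?case using assms by (simp add: continuous_on_inverse)
next
  case (Suc k)
  note mult = times_differentiable_on_bilinear[OF bounded_bilinear_mult \<open>open S\<close>]
  have inv: "times_differentiable_on k (\<lambda>q. inverse (f q)) S"
    using Suc times_differentiable_on_SucD by blast
  have "((\<lambda>q. inverse (f q)) has_derivative
      (\<lambda>v. (- 1) * (inverse (f q) * frechet_derivative f (at q) v * inverse (f q)))) (at q)" if "q \<in> S" for q
    using Deriv.has_derivative_inverse[OF assms(3)[OF that] times_differentiable_on_Suc_has_derivative[OF Suc.prems that]]
    by simp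
  then show ?case
    by (rule times_differentiable_on_SucI[OF \<open>open S\<close>])
      (assumption, intro times_differentiable_on_linear[OF \<open>open S\<close> bounded_linear_mult_right] mult inv,
       use Suc.prems in simp)
qed

text \<open>The same bootstrap, with derivative \<open>f' / (2 sqrt f)\<close>; positivity of
  \<open>f\<close> keeps the denominator away from zero.\<close>

lemma times_differentiable_on_sqrt:
  fixes f :: "'a::real_normed_vector \<Rightarrow> real"
  assumes "open S" "times_differentiable_on k f S" "\<And>q. q \<in> S \<Longrightarrow> f q > 0"
  shows "times_differentiable_on k (\<lambda>q. sqrt (f q)) S"
  using assms(2)
proof (induction k)
  case 0
  then show ?case by (simp add: continuous_on_real_sqrt)
next
  case (Suc k)
  note mult = times_differentiable_on_bilinear[OF bounded_bilinear_mult \<open>open S\<close>]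
  have "times_differentiable_on k (\<lambda>q. sqrt (f q)) S"
    using Suc times_differentiable_on_SucD by blast
  then have inv: "times_differentiable_on k (\<lambda>q. inverse (sqrt (f q))) S"
    by (rule times_differentiable_on_inverse[OF \<open>open S\<close>]) (use assms(3) in force)
  have "((\<lambda>q. sqrt (f q)) has_derivative
      (\<lambda>v. (1/2) * (frechet_derivative f (at q) v * inverse (sqrt (f q))))) (at q)" if "q \<in> S" for q
  proof -
    have "(sqrt has_derivative (*) (inverse (sqrt (f q)) / 2)) (at (f q))"
      using DERIV_real_sqrt[OF assms(3)[OF that]] by (simp add: has_field_derivative_def)
    from has_derivative_compose[OF times_differentiable_on_Suc_has_derivative[OF Suc.prems that] this]
    show ?thesis by (simp add: algebra_simps)
  qed
  then show ?case
    by (rule times_differentiable_on_SucI[OF \<open>open S\<close>])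
      (assumption, intro times_differentiable_on_linear[OF \<open>open S\<close> bounded_linear_mult_right] mult inv,
       use Suc.prems in simp)
qed

lemma smooth_on_imp_continuous_on: "smooth_on S f \<Longrightarrow> continuous_on S f"
  unfolding smooth_on_def using times_differentiable_on.simps(1) by blast

lemma smooth_on_imp_differentiable: "smooth_on S f \<Longrightarrow> q \<in> S \<Longrightarrow> f differentiable (at q)"
  unfolding smooth_on_def using times_differentiable_on.simps(2) by blast

lemma smooth_on_frechet_derivative:
  "smooth_on S f \<Longrightarrow> smooth_on S (\<lambda>q. frechet_derivative f (at q) v)"
  unfolding smooth_on_def using times_differentiable_on.simps(2) by blast

lemma smooth_on_subset:
  assumes "smooth_on T f" "S \<subseteq> T"
  shows "smooth_on S f"
proof -
  have "times_differentiable_on k f T \<Longrightarrow> times_differentiable_on k f S" for k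
  proof (induction k arbitrary: f)
    case 0
    then show ?case using assms(2) by (simp add: continuous_on_subset)
  next
    case (Suc k)
    then show ?case using assms(2) by (simp add: subset_iff)
  qed
  then show ?thesis using assms by (simp add: smooth_on_def)
qed

lemma smooth_on_cong:
  "open S \<Longrightarrow> (\<And>q. q \<in> S \<Longrightarrow> f q = g q) \<Longrightarrow> smooth_on S f \<longleftrightarrow> smooth_on S g"
  unfolding smooth_on_def using times_differentiable_on_cong[of S f g] by blast

lemma smooth_on_const: "smooth_on S (\<lambda>q. c)"
  by (simp add: smooth_on_def times_differentiable_on_const)

lemma smooth_on_linear:
  "open S \<Longrightarrow> bounded_linear h \<Longrightarrow> smooth_on S f \<Longrightarrow> smooth_on S (\<lambda>q. h (f q))"
  by (simp add: smooth_on_def times_differentiable_on_linear)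

lemma smooth_on_add:
  "open S \<Longrightarrow> smooth_on S f \<Longrightarrow> smooth_on S g \<Longrightarrow> smooth_on S (\<lambda>q. f q + g q)"
  by (simp add: smooth_on_def times_differentiable_on_add)

lemma smooth_on_minus: "open S \<Longrightarrow> smooth_on S f \<Longrightarrow> smooth_on S (\<lambda>q. - f q)"
  by (rule smooth_on_linear[OF _ bounded_linear_minus[OF bounded_linear_ident]])

lemma smooth_on_diff:
  "open S \<Longrightarrow> smooth_on S f \<Longrightarrow> smooth_on S g \<Longrightarrow> smooth_on S (\<lambda>q. f q - g q)"
  using smooth_on_add[of S f "\<lambda>q. - g q"] smooth_on_minus[of S g] by simp

lemma smooth_on_sum:
  "open S \<Longrightarrow> (\<And>i. i \<in> I \<Longrightarrow> smooth_on S (f i)) \<Longrightarrow> smooth_on S (\<lambda>q. \<Sum>i\<in>I. f i q)"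
  by (induction I rule: infinite_finite_induct) (auto intro: smooth_on_const smooth_on_add)

lemma smooth_on_bilinear:
  "bounded_bilinear b \<Longrightarrow> open S \<Longrightarrow> smooth_on S f \<Longrightarrow> smooth_on S g \<Longrightarrow>
     smooth_on S (\<lambda>q. b (f q) (g q))"
  by (simp add: smooth_on_def times_differentiable_on_bilinear)

lemmas smooth_on_mult = smooth_on_bilinear[OF bounded_bilinear_mult]

lemma smooth_on_inverse:
  fixes f :: "'a::real_normed_vector \<Rightarrow> real"
  shows "open S \<Longrightarrow> smooth_on S f \<Longrightarrow> (\<And>q. q \<in> S \<Longrightarrow> f q \<noteq> 0) \<Longrightarrow> smooth_on S (\<lambda>q. inverse (f q))"
  by (simp add: smooth_on_def times_differentiable_on_inverse)

lemma smooth_on_sqrt: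
  fixes f :: "'a::real_normed_vector \<Rightarrow> real"
  shows "open S \<Longrightarrow> smooth_on S f \<Longrightarrow> (\<And>q. q \<in> S \<Longrightarrow> f q > 0) \<Longrightarrow> smooth_on S (\<lambda>q. sqrt (f q))"
  by (simp add: smooth_on_def times_differentiable_on_sqrt)

lemma smooth_on_norm:
  fixes f :: "'a::real_normed_vector \<Rightarrow> 'b::real_inner"
  assumes "open S" "smooth_on S f" "\<And>q. q \<in> S \<Longrightarrow> f q \<noteq> 0"
  shows "smooth_on S (\<lambda>q. norm (f q))"
  unfolding norm_eq_sqrt_inner
  by (rule smooth_on_sqrt[OF assms(1) smooth_on_bilinear[OF bounded_bilinear_inner assms(1,2,2)]])
    (simp add: assms(3))

section \<open>Smoothness of vector and matrix operations, entry by entry\<close>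

lemma smooth_on_nth:
  "open S \<Longrightarrow> smooth_on S f \<Longrightarrow> smooth_on S (\<lambda>q. f q $ i)"
  by (rule smooth_on_linear[OF _ bounded_linear_vec_nth])

text \<open>A vector is the sum of its components placed on the axes, and each placement is a
  bounded linear map.\<close>

lemma smooth_on_vec:
  fixes f :: "'a::real_normed_vector \<Rightarrow> 'b::euclidean_space ^ 'n"
  assumes "open S" "\<And>i. smooth_on S (\<lambda>q. f q $ i)"
  shows "smooth_on S f"
proof -
  have lin: "bounded_linear (\<lambda>y. axis i y :: 'b^'n)" for i
    unfolding linear_conv_bounded_linear[symmetric]
    by (auto intro!: linearI simp: axis_def vec_eq_iff)
  have "f = (\<lambda>q. \<Sum>i\<in>UNIV. axis i (f q $ i))"
    by (simp add: fun_eq_iff vec_eq_iff axis_def if_distrib sum.delta cong: if_cong)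
  moreover have "smooth_on S (\<lambda>q. \<Sum>i\<in>UNIV. axis i (f q $ i))"
    by (intro smooth_on_sum[OF assms(1)] smooth_on_linear[OF assms(1) lin assms(2)])
  ultimately show ?thesis by simp
qed

lemma smooth_on_entry:
  "open S \<Longrightarrow> smooth_on S A \<Longrightarrow> smooth_on S (\<lambda>q. A q $ i $ j)"
  by (intro smooth_on_nth)

lemma smooth_on_column:
  fixes A :: "'a::real_normed_vector \<Rightarrow> real^'n^'m"
  shows "open S \<Longrightarrow> smooth_on S A \<Longrightarrow> smooth_on S (\<lambda>q. column j (A q))"
  by (rule smooth_on_vec) (simp_all add: column_def smooth_on_entry)

lemma smooth_on_transpose:
  fixes A :: "'a::real_normed_vector \<Rightarrow> real^'n^'m"
  shows "open S \<Longrightarrow> smooth_on S A \<Longrightarrow> smooth_on S (\<lambda>q. transpose (A q))"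
  by (intro smooth_on_vec) (simp_all add: transpose_def smooth_on_entry)

lemma smooth_on_matrix_mult:
  fixes A :: "'a::real_normed_vector \<Rightarrow> real^'n^'m" and B :: "'a \<Rightarrow> real^'k^'n"
  shows "open S \<Longrightarrow> smooth_on S A \<Longrightarrow> smooth_on S B \<Longrightarrow> smooth_on S (\<lambda>q. A q ** B q)"
  by (intro smooth_on_vec)
    (simp_all add: matrix_matrix_mult_def smooth_on_entry smooth_on_sum smooth_on_mult)

lemma smooth_on_det2:
  fixes A :: "'a::real_normed_vector \<Rightarrow> real^2^2"
  shows "open S \<Longrightarrow> smooth_on S A \<Longrightarrow> smooth_on S (\<lambda>q. det (A q))"
  by (simp add: det_2 smooth_on_entry smooth_on_mult smooth_on_diff)

lemma smooth_on_trace: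
  fixes A :: "'a::real_normed_vector \<Rightarrow> real^'n^'n"
  shows "open S \<Longrightarrow> smooth_on S A \<Longrightarrow> smooth_on S (\<lambda>q. trace (A q))"
  by (simp add: trace_def smooth_on_entry smooth_on_sum)

section \<open>Adjugate and inverse of 2 by 2 matrices, smoothness of the Jacobian and of the cross
  product\<close>

lemma adj2_nth [simp]:
  "adj2 A $ 1 $ 1 = A $ 2 $ 2" "adj2 A $ 1 $ 2 = - A $ 1 $ 2"
  "adj2 A $ 2 $ 1 = - A $ 2 $ 1" "adj2 A $ 2 $ 2 = A $ 1 $ 1"
  by (simp_all add: adj2_def)

lemma smooth_on_adj2:
  assumes "open S" "smooth_on S A"
  shows "smooth_on S (\<lambda>q. adj2 (A q))"
proof -
  have "\<forall>i j. smooth_on S (\<lambda>q. adj2 (A q) $ i $ j)"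
    by (simp add: forall_2 smooth_on_minus smooth_on_entry assms)
  then show ?thesis by (intro smooth_on_vec assms(1)) blast
qed

lemma adj2_mult: "adj2 A ** A = det A *\<^sub>R mat 1" "A ** adj2 A = det A *\<^sub>R mat 1"
  by (simp_all add: vec_eq_iff forall_2 matrix_matrix_mult_def sum_2 mat_def det_2 algebra_simps)

text \<open>\<open>matrix_inv\<close> is a choice. The adjugate formula shows that a two-sided
  inverse exists, so the chosen matrix is a right inverse; associativity then makes it equal to the
  left inverse \<open>?B\<close>.\<close>

lemma matrix_inv_2:
  fixes A :: "real^2^2"
  assumes "det A \<noteq> 0"
  shows "matrix_inv A = inverse (det A) *\<^sub>R adj2 A"
proof -
  let ?B = "inverse (det A) *\<^sub>R adj2 A"
  have AB: "A ** ?B = mat 1" and BA: "?B ** A = mat 1"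
    using assms by (simp_all add: adj2_mult matrix_scalar_ac scalar_matrix_assoc[symmetric])
  then have "A ** matrix_inv A = mat 1"
    unfolding matrix_inv_def using someI[of "\<lambda>B. A ** B = mat 1 \<and> B ** A = mat 1" ?B] by blast
  then have "matrix_inv A = (?B ** A) ** matrix_inv A" "?B ** (A ** matrix_inv A) = ?B"
    using BA by simp_all
  then show ?thesis by (simp only: matrix_mul_assoc)
qed

lemma smooth_on_matrix_inv_2:
  fixes A :: "'a::real_normed_vector \<Rightarrow> real^2^2"
  assumes "open S" "smooth_on S A" "\<And>q. q \<in> S \<Longrightarrow> det (A q) \<noteq> 0"
  shows "smooth_on S (\<lambda>q. matrix_inv (A q))"
proof -
  have "smooth_on S (\<lambda>q. inverse (det (A q)) *\<^sub>R adj2 (A q))"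
    by (intro smooth_on_bilinear[OF bounded_bilinear_scaleR] smooth_on_inverse smooth_on_det2 smooth_on_adj2 assms)
  then show ?thesis
    using smooth_on_cong[OF assms(1), of "\<lambda>q. matrix_inv (A q)"
        "\<lambda>q. inverse (det (A q)) *\<^sub>R adj2 (A q)"]
    by (simp add: matrix_inv_2 assms(3))
qed

lemma smooth_on_jacobian:
  fixes f :: "real^'n \<Rightarrow> real^'m"
  assumes "open S" "smooth_on S f"
  shows "smooth_on S (\<lambda>q. jacobian f (at q))"
  by (intro smooth_on_vec)
   (simp_all add: jacobian_def matrix_def smooth_on_nth smooth_on_frechet_derivative assms)

lemma smooth_on_cross3:
  fixes f g :: "'a::real_normed_vector \<Rightarrow> real^3"
  assumes "open S" "smooth_on S f" "smooth_on S g"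
  shows "smooth_on S (\<lambda>q. cross3 (f q) (g q))"
proof -
  have "\<forall>i. smooth_on S (\<lambda>q. cross3 (f q) (g q) $ i)"
    by (simp add: forall_3 cross_components smooth_on_diff smooth_on_mult smooth_on_nth assms)
  then show ?thesis by (intro smooth_on_vec assms(1)) blast
qed

subsection \<open>Symmetry of second derivatives\<close>

text \<open>Two applications of the mean value theorem: first in direction \<open>u\<close> to the
  difference of \<open>f\<close> along two parallel segments, then in direction \<open>v\<close> to
  the derivative \<open>f1\<close> of \<open>f\<close> along \<open>u\<close>.\<close>

lemma second_difference_mean_value:
  fixes f :: "'a::real_normed_vector \<Rightarrow> real"
  assumes f: "times_differentiable_on 2 f S" and h: "h > 0"
    and S: "\<And>s t. 0 \<le> s \<Longrightarrow> s \<le> h \<Longrightarrow> 0 \<le> t \<Longrightarrow> t \<le> h \<Longrightarrow> p + s *\<^sub>R u + t *\<^sub>R v \<in> S"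
  shows "\<exists>s t. 0 < s \<and> s < h \<and> 0 < t \<and> t < h \<and>
    f (p + h *\<^sub>R u + h *\<^sub>R v) - f (p + h *\<^sub>R u) - f (p + h *\<^sub>R v) + f p =
    h * h * frechet_derivative (\<lambda>q. frechet_derivative f (at q) u) (at (p + s *\<^sub>R u + t *\<^sub>R v)) v"
proof -
  have d1: "(f has_derivative frechet_derivative f (at q)) (at q)" if "q \<in> S" for q
    using f that by (simp add: numeral_2_eq_2 frechet_derivative_works)
  define f1 where "f1 = (\<lambda>q. frechet_derivative f (at q) u)"
  have d2: "(f1 has_derivative frechet_derivative f1 (at q)) (at q)" if "q \<in> S" for q
    using f that by (simp add: numeral_2_eq_2 frechet_derivative_works f1_def)
  \<comment> \<open>The term \<open>0 *\<^sub>R v\<close> is kept so that \<open>line1\<close>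
    applies to both summands, with \<open>t = h\<close> and with \<open>t = 0\<close>.\<close>
  define g where "g = (\<lambda>s. f (p + s *\<^sub>R u + h *\<^sub>R v) - f (p + s *\<^sub>R u + 0 *\<^sub>R v))"
  have line1: "((\<lambda>s. f (p + s *\<^sub>R u + t *\<^sub>R v)) has_real_derivative f1 (p + s *\<^sub>R u + t *\<^sub>R v)) (at s)"
    if "0 \<le> s" "s \<le> h" "0 \<le> t" "t \<le> h" for s t
  proof -
    have "linear (frechet_derivative f (at (p + s *\<^sub>R u + t *\<^sub>R v)))"
      using d1 S that has_derivative_linear by blast
    moreover have "((\<lambda>s. p + s *\<^sub>R u + t *\<^sub>R v) has_derivative (\<lambda>x. x *\<^sub>R u)) (at s)"
      by (auto intro!: derivative_eq_intros)
    from has_derivative_compose[OF this d1[OF S[OF that]]]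
    have "((\<lambda>s. f (p + s *\<^sub>R u + t *\<^sub>R v)) has_derivative
        (\<lambda>x. frechet_derivative f (at (p + s *\<^sub>R u + t *\<^sub>R v)) (x *\<^sub>R u))) (at s)" .
    ultimately show ?thesis
      by (simp add: has_field_derivative_def f1_def linear_cmul mult_commute_abs)
  qed
  have line2: "((\<lambda>t. f1 (p + s *\<^sub>R u + t *\<^sub>R v)) has_real_derivative
      frechet_derivative f1 (at (p + s *\<^sub>R u + t *\<^sub>R v)) v) (at t)"
    if "0 \<le> s" "s \<le> h" "0 \<le> t" "t \<le> h" for s t
  proof -
    have "linear (frechet_derivative f1 (at (p + s *\<^sub>R u + t *\<^sub>R v)))"
      using d2 S that has_derivative_linear by blast
    moreover have "((\<lambda>t. p + s *\<^sub>R u + t *\<^sub>R v) has_derivative (\<lambda>x. x *\<^sub>R v)) (at t)"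
      by (auto intro!: derivative_eq_intros)
    from has_derivative_compose[OF this d2[OF S[OF that]]]
    have "((\<lambda>t. f1 (p + s *\<^sub>R u + t *\<^sub>R v)) has_derivative
        (\<lambda>x. frechet_derivative f1 (at (p + s *\<^sub>R u + t *\<^sub>R v)) (x *\<^sub>R v))) (at t)" .
    ultimately show ?thesis
      by (simp add: has_field_derivative_def linear_cmul mult_commute_abs)
  qed
  have "(g has_real_derivative f1 (p + s *\<^sub>R u + h *\<^sub>R v) - f1 (p + s *\<^sub>R u + 0 *\<^sub>R v)) (at s)"
    if "0 \<le> s" "s \<le> h" for s
    unfolding g_def using h that by (intro DERIV_diff line1) auto
  from MVT2[OF h this] obtain s where s: "0 < s" "s < h"
    "g h - g 0 = h * (f1 (p + s *\<^sub>R u + h *\<^sub>R v) - f1 (p + s *\<^sub>R u + 0 *\<^sub>R v))"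
    by auto
  have "\<exists>t. 0 < t \<and> t < h \<and> f1 (p + s *\<^sub>R u + h *\<^sub>R v) - f1 (p + s *\<^sub>R u + 0 *\<^sub>R v) =
      (h - 0) * frechet_derivative f1 (at (p + s *\<^sub>R u + t *\<^sub>R v)) v"
    by (rule MVT2[OF h]) (use s line2 in auto)
  then obtain t where "0 < t" "t < h" "f1 (p + s *\<^sub>R u + h *\<^sub>R v) - f1 (p + s *\<^sub>R u + 0 *\<^sub>R v) =
      h * frechet_derivative f1 (at (p + s *\<^sub>R u + t *\<^sub>R v)) v"
    by auto
  with s show ?thesis
    unfolding f1_def by (intro exI[of _ s] exI[of _ t]) (auto simp: g_def)
qed

text \<open>The second difference over a parallelogram is symmetric in \<open>u\<close> and
  \<open>v\<close>. Divided by \<open>h * h\<close>, it is a value of each of the two mixed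
  derivatives at a point near \<open>p\<close>, and continuity forces these derivatives to agree at
  \<open>p\<close>.\<close>

lemma symmetric_second_derivative:
  fixes f :: "'a::real_normed_vector \<Rightarrow> real"
  assumes "open S" "p \<in> S" and f: "times_differentiable_on 2 f S"
  shows "frechet_derivative (\<lambda>q. frechet_derivative f (at q) u) (at p) v =
         frechet_derivative (\<lambda>q. frechet_derivative f (at q) v) (at p) u"
proof (rule ccontr)
  define A where "A = (\<lambda>q. frechet_derivative (\<lambda>q. frechet_derivative f (at q) u) (at q) v)"
  define B where "B = (\<lambda>q. frechet_derivative (\<lambda>q. frechet_derivative f (at q) v) (at q) u)"
  assume "\<not> ?thesis"
  then have ne: "A p \<noteq> B p" by (simp add: A_def B_def)
  \<comment> \<open>Half the supposed gap: two errors below \<open>e\<close> cannot add up to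
    it.\<close>
  define e where "e = \<bar>A p - B p\<bar> / 2"
  have e: "e > 0" using ne by (simp add: e_def)
  have "continuous_on S A" "continuous_on S B"
    using f by (simp_all add: numeral_2_eq_2 A_def B_def)
  then have "isCont A p" "isCont B p"
    using \<open>open S\<close> \<open>p \<in> S\<close> by (simp_all add: continuous_on_eq_continuous_at)
  then obtain d1 d2 where d1: "d1 > 0" "\<And>q. dist q p < d1 \<Longrightarrow> dist (A q) (A p) < e"
    and d2: "d2 > 0" "\<And>q. dist q p < d2 \<Longrightarrow> dist (B q) (B p) < e"
    using e unfolding continuous_at_eps_delta by metis
  obtain d3 where d3: "d3 > 0" "ball p d3 \<subseteq> S"
    using \<open>open S\<close> \<open>p \<in> S\<close> open_contains_ball by blast
  define d where "d = min d1 (min d2 d3)"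
  have d: "d > 0" using d1 d2 d3 by (simp add: d_def)
  \<comment> \<open>Small enough that the parallelogram spanned by \<open>h *\<^sub>R u\<close> and
    \<open>h *\<^sub>R v\<close> at \<open>p\<close> stays within distance \<open>d\<close>; the
    summand 1 keeps the denominator positive when \<open>u = v = 0\<close>.\<close>
  define h where "h = d / (2 * (norm u + norm v + 1))"
  have pos: "norm u + norm v + 1 > 0" by (simp add: add_nonneg_pos)
  have h: "h > 0" using d pos by (simp add: h_def)
  have near: "dist (p + s *\<^sub>R u + t *\<^sub>R v) p < d"
    if "0 \<le> s" "s \<le> h" "0 \<le> t" "t \<le> h" for s t
  proof -
    have "dist (p + s *\<^sub>R u + t *\<^sub>R v) p \<le> s * norm u + t * norm v"
      using that norm_triangle_ineq[of "s *\<^sub>R u" "t *\<^sub>R v"] by (simp add: dist_norm add.assoc)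
    also have "\<dots> \<le> h * norm u + h * norm v"
      using that by (intro add_mono mult_right_mono) auto
    also have "\<dots> < h * (2 * (norm u + norm v + 1))"
      using h mult_pos_pos[OF h pos] by (simp add: algebra_simps)
    also have "\<dots> = d" using pos by (simp add: h_def)
    finally show ?thesis .
  qed
  have inS: "p + s *\<^sub>R u + t *\<^sub>R v \<in> S" if "0 \<le> s" "s \<le> h" "0 \<le> t" "t \<le> h" for s t
    using near[OF that] d3 by (auto simp: d_def dist_commute)
  have inS': "p + s *\<^sub>R v + t *\<^sub>R u \<in> S" if "0 \<le> s" "s \<le> h" "0 \<le> t" "t \<le> h" for s t
    using inS[OF that(3,4,1,2)] by (simp add: algebra_simps)
  obtain s t where st: "0 < s" "s < h" "0 < t" "t < h"
    "f (p + h *\<^sub>R u + h *\<^sub>R v) - f (p + h *\<^sub>R u) - f (p + h *\<^sub>R v) + f p = h * h * A (p + s *\<^sub>R u + t *\<^sub>R v)"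
    using second_difference_mean_value[OF f h inS] unfolding A_def by blast
  obtain s' t' where st': "0 < s'" "s' < h" "0 < t'" "t' < h"
    "f (p + h *\<^sub>R v + h *\<^sub>R u) - f (p + h *\<^sub>R v) - f (p + h *\<^sub>R u) + f p = h * h * B (p + s' *\<^sub>R v + t' *\<^sub>R u)"
    using second_difference_mean_value[OF f h inS'] unfolding B_def by blast
  have swap: "p + a *\<^sub>R v + b *\<^sub>R u = p + b *\<^sub>R u + a *\<^sub>R v" for a b
    by simp
  have "h * h * A (p + s *\<^sub>R u + t *\<^sub>R v) = h * h * B (p + t' *\<^sub>R u + s' *\<^sub>R v)"
    using st(5) st'(5) unfolding swap by linarith
  then have "A (p + s *\<^sub>R u + t *\<^sub>R v) = B (p + t' *\<^sub>R u + s' *\<^sub>R v)"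
    using h by simp
  moreover have "dist (A (p + s *\<^sub>R u + t *\<^sub>R v)) (A p) < e"
    using near[of s t] st by (intro d1) (simp add: d_def)
  moreover have "dist (B (p + t' *\<^sub>R u + s' *\<^sub>R v)) (B p) < e"
    using near[of t' s'] st' by (intro d2) (simp add: d_def)
  ultimately have "dist (A p) (B p) < e + e"
    by (metis dist_commute dist_triangle_less_add)
  then show False by (simp add: e_def dist_real_def)
qed

lemma symmetric_second_derivative_vec:
  fixes f :: "'a::real_normed_vector \<Rightarrow> real^'n"
  assumes "open S" "p \<in> S" and f: "times_differentiable_on 2 f S"
  shows "frechet_derivative (\<lambda>q. frechet_derivative f (at q) u) (at p) v =
         frechet_derivative (\<lambda>q. frechet_derivative f (at q) v) (at p) u"
proof -
  have nth: "frechet_derivative (\<lambda>q. g q $ i) (at q) w = frechet_derivative g (at q) w $ i"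
    if "g differentiable (at q)" for g :: "'a \<Rightarrow> real^'n" and i q w
    using frechet_derivative_at[OF bounded_linear.has_derivative[OF bounded_linear_vec_nth
          that[unfolded frechet_derivative_works]], of i] by metis
  have d1: "f differentiable (at q)" if "q \<in> S" for q
    using f that by (simp add: numeral_2_eq_2)
  have d2: "(\<lambda>q. frechet_derivative f (at q) w) differentiable (at q)" if "q \<in> S" for q w
    using f that by (simp add: numeral_2_eq_2)
  have "frechet_derivative (\<lambda>q. frechet_derivative (\<lambda>q. f q $ i) (at q) w) (at p) w' =
      frechet_derivative (\<lambda>q. frechet_derivative f (at q) w) (at p) w' $ i" for i w w'
  proof -
    have "(\<lambda>q. frechet_derivative f (at q) w $ i) differentiable (at p)"
      using bounded_linear.has_derivative[OF bounded_linear_vec_nth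
          d2[OF \<open>p \<in> S\<close>, of w, unfolded frechet_derivative_works], of i]
      by (rule differentiableI)
    then have "frechet_derivative (\<lambda>q. frechet_derivative f (at q) w $ i) (at p) =
        frechet_derivative (\<lambda>q. frechet_derivative (\<lambda>q. f q $ i) (at q) w) (at p)"
      by (rule frechet_derivative_transform_within_open[OF _ \<open>open S\<close> \<open>p \<in> S\<close>]) (simp add: nth d1)
    then show ?thesis using nth[OF d2[OF \<open>p \<in> S\<close>, of w], of i w'] by simp
  qed
  moreover have "times_differentiable_on 2 (\<lambda>q. f q $ i) S" for i
    by (rule times_differentiable_on_linear[OF \<open>open S\<close> bounded_linear_vec_nth f])
  from symmetric_second_derivative[OF assms(1,2) this]
  have "frechet_derivative (\<lambda>q. frechet_derivative (\<lambda>q. f q $ i) (at q) u) (at p) v =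
      frechet_derivative (\<lambda>q. frechet_derivative (\<lambda>q. f q $ i) (at q) v) (at p) u" for i .
  ultimately show ?thesis by (simp add: vec_eq_iff)
qed

subsection \<open>Fundamental forms relative to a tangent moving basis\<close>

lemma matrix_mult_minus: "A ** (- B) = - (A ** B)" "(- A) ** B = - (A ** B)"
  for A :: "real^'n^'m" and B :: "real^'k^'n"
  by (simp_all add: vec_eq_iff matrix_matrix_mult_def sum_negf)

text \<open>For symmetric \<open>P\<close> and \<open>Q\<close> the left side is the trace of
  \<open>Q ** adj2 P\<close>. The adjugate reverses products, so by cyclicity of the trace
  \<open>adj2 L ** L\<close> and \<open>adj2 A ** A\<close> collapse to determinants. The proof
  checks the resulting polynomial identity on entries.\<close>

lemma mean_curvature_numerator:
  fixes L A M :: "real^2^2"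
  defines "P \<equiv> L ** A ** transpose L" and "Q \<equiv> - (L ** A ** transpose M)"
  assumes "transpose A = A" "Q$1$2 = Q$2$1"
  shows "Q$1$1 * P$2$2 + Q$2$2 * P$1$1 - 2 * Q$1$2 * P$1$2 =
     - (det L * det A * trace (M ** adj2 L))"
proof -
  have A: "A$2$1 = A$1$2"
    using arg_cong[OF assms(3), of "\<lambda>B. B$1$2"] by (simp add: transpose_def)
  have "P$2$1 = P$1$2"
    using A by (simp add: P_def matrix_matrix_mult_def sum_2 transpose_def algebra_simps)
  \<comment> \<open>Splitting the doubled mixed term uses both symmetries and leaves the trace of
    \<open>Q ** adj2 P\<close>, for which a polynomial identity in the entries remains.\<close>
  then have "Q$1$1 * P$2$2 + Q$2$2 * P$1$1 - 2 * Q$1$2 * P$1$2 =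
      Q$1$1 * P$2$2 + Q$2$2 * P$1$1 - Q$1$2 * P$2$1 - Q$2$1 * P$1$2"
    using assms(4) by simp
  also have "\<dots> = - (det L * det A * trace (M ** adj2 L))"
    unfolding P_def Q_def
    by (simp add: matrix_matrix_mult_def sum_2 transpose_def det_2 trace_def A) algebra
  finally show ?thesis .
qed

lemma cross3_neq_0:
  assumes "w1 \<noteq> w2" "independent {w1, w2}"
  shows "cross3 w1 w2 \<noteq> 0"
proof
  assume "cross3 w1 w2 = 0"
  then consider "w1 = 0" | "w2 = 0" | c where "w2 = c *\<^sub>R w1"
    by (auto simp: cross_eq_0 collinear_lemma)
  then show False
  proof cases
    case 3
    then have "w2 \<in> span {w1}" by (simp add: span_base span_scale)
    then show False using assms by (auto simp: independent_insert insert_commute[of w1 w2])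
  qed (use assms dependent_zero in auto)
qed

lemma span_pairE:
  assumes "y \<in> span {w1, w2}"
  obtains a b where "y = a *\<^sub>R w1 + b *\<^sub>R w2"
  using assms that by (auto simp: span_breakdown_eq[of _ w1] span_singleton diff_eq_eq add.commute)

text \<open>This is the inequality between \<open>K\<close> and the square of \<open>H\<close>,
  which makes the principal curvatures real.\<close>

lemma principal_curvature_discriminant:
  fixes e f g E F G :: real
  assumes "E > 0" "E * G - F\<^sup>2 > 0"
  shows "(e * g - f\<^sup>2) / (E * G - F\<^sup>2) \<le> ((e * G + g * E - 2 * f * F) / (2 * (E * G - F\<^sup>2)))\<^sup>2"
proof -
  define D where "D = E * G - F\<^sup>2"
  have D: "D > 0" using assms by (simp add: D_def)
  \<comment> \<open>Completing the square: multiplied by the square of \<open>E\<close>, the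
    discriminant becomes a square plus a positive multiple of a square.\<close>
  have "E\<^sup>2 * ((e * G + g * E - 2 * f * F)\<^sup>2 - 4 * (e * g - f\<^sup>2) * (E * G - F\<^sup>2)) =
      4 * (E * G - F\<^sup>2) * (E * f - F * e)\<^sup>2 + (E * (E * g - e * G) - 2 * F * (E * f - F * e))\<^sup>2"
    by algebra
  also have "\<dots> \<ge> 0" using assms by simp
  finally have "4 * (e * g - f\<^sup>2) * D \<le> (e * G + g * E - 2 * f * F)\<^sup>2"
    using assms(1) by (simp add: zero_le_mult_iff D_def)
  then have "4 * (e * g - f\<^sup>2) * D / (2 * D)\<^sup>2 \<le> (e * G + g * E - 2 * f * F)\<^sup>2 / (2 * D)\<^sup>2"
    by (rule divide_right_mono) simp
  moreover have "4 * (e * g - f\<^sup>2) * D / (2 * D)\<^sup>2 = (e * g - f\<^sup>2) / D"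
    using D by (simp add: power2_eq_square field_simps)
  ultimately show ?thesis by (simp add: power_divide D_def)
qed

section \<open>Factorizations and determinants for a map with a tangent moving basis\<close>

locale moving_basis =
  fixes U :: "(real^2) set" and x :: "real^2 \<Rightarrow> real^3" and \<Omega> :: "real^2 \<Rightarrow> real^2^3"
  assumes open_U: "open U" and smooth_x: "smooth_on U x" and tmb: "tangent_moving_basis U x \<Omega>"
begin

lemma smooth_Omega: "smooth_on U \<Omega>"
  using tmb by (simp add: tangent_moving_basis_def)

lemma cross_columns_neq_0: "q \<in> U \<Longrightarrow> cross3 (column 1 (\<Omega> q)) (column 2 (\<Omega> q)) \<noteq> 0"
  using tmb cross3_neq_0 unfolding tangent_moving_basis_def Let_def by blast

text \<open>Lagrange's identity: the Gram determinant of two vectors is the squared norm of their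
  cross product. Linear independence of the columns thereby yields positivity.\<close>

lemma det_I_rel: "det (I_rel \<Omega> q) = (norm (cross3 (column 1 (\<Omega> q)) (column 2 (\<Omega> q))))\<^sup>2"
  unfolding norm_cross unfolding power2_norm_eq_inner
  by (simp add: I_rel_def det_2 matrix_matrix_mult_def transpose_def column_def inner_vec_def
      power2_eq_square mult.commute)

lemma det_I_rel_pos: "q \<in> U \<Longrightarrow> det (I_rel \<Omega> q) > 0"
  by (simp add: det_I_rel cross_columns_neq_0)

lemma transpose_I_rel: "transpose (I_rel \<Omega> q) = I_rel \<Omega> q"
  by (simp add: I_rel_def matrix_transpose_mul)

lemma I_rel_inverse:
  assumes "q \<in> U"
  shows "I_rel \<Omega> q ** matrix_inv (I_rel \<Omega> q) = mat 1" "matrix_inv (I_rel \<Omega> q) ** I_rel \<Omega> q = mat 1"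
  using det_I_rel_pos[OF assms]
  by (simp_all add: matrix_inv_2 adj2_mult matrix_scalar_ac scalar_matrix_assoc[symmetric])

lemma normal_orthogonal_span:
  assumes "q \<in> U" "y \<in> span {column 1 (\<Omega> q), column 2 (\<Omega> q)}"
  shows "normal \<Omega> q \<bullet> y = 0"
proof -
  obtain a b where "y = a *\<^sub>R column 1 (\<Omega> q) + b *\<^sub>R column 2 (\<Omega> q)"
    using span_pairE[OF assms(2)] by blast
  then show ?thesis
    by (simp add: normal_def Let_def inner_add_right dot_cross_self)
qed

lemma Df_factor:
  assumes "q \<in> U"
  shows "Df x q = \<Omega> q ** transpose (Lambda_rel x \<Omega> q)"
proof -
  have "column j (Df x q) \<in> span {column 1 (\<Omega> q), column 2 (\<Omega> q)}" for j
    using tmb assms exhaust_2[of j] unfolding tangent_moving_basis_def Let_def by auto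
  then have "\<exists>a b. column j (Df x q) = a *\<^sub>R column 1 (\<Omega> q) + b *\<^sub>R column 2 (\<Omega> q)" for j
    by (rule span_pairE) blast
  then obtain a b where ab: "column j (Df x q) = a j *\<^sub>R column 1 (\<Omega> q) + b j *\<^sub>R column 2 (\<Omega> q)" for j
    by metis
  \<comment> \<open>The coefficients of the two partial derivatives in the moving basis, arranged as
    columns. Cancelling the Gram matrix then identifies \<open>Lambda_rel\<close> with the transpose
    of \<open>M\<close>.\<close>
  define M :: "real^2^2" where "M = (\<chi> i j. if i = 1 then a j else b j)"
  have "Df x q $ i $ j = (\<Omega> q ** M) $ i $ j" for i j
    using ab[of j] by (simp add: M_def matrix_matrix_mult_def sum_2 column_def vec_eq_iff mult.commute)
  then have DM: "Df x q = \<Omega> q ** M" by (simp add: vec_eq_iff)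
  have "Lambda_rel x \<Omega> q = transpose M ** (transpose (\<Omega> q) ** \<Omega> q) ** matrix_inv (I_rel \<Omega> q)"
    unfolding Lambda_rel_def DM by (simp add: matrix_transpose_mul matrix_mul_assoc)
  also have "\<dots> = transpose M ** (I_rel \<Omega> q ** matrix_inv (I_rel \<Omega> q))"
    by (simp add: I_rel_def matrix_mul_assoc)
  finally show ?thesis using DM by (simp add: I_rel_inverse assms)
qed

lemma form1_eq:
  assumes "q \<in> U"
  shows "form1 x q = Lambda_rel x \<Omega> q ** I_rel \<Omega> q ** transpose (Lambda_rel x \<Omega> q)"
  unfolding form1_def Df_factor[OF assms]
  by (simp add: matrix_transpose_mul I_rel_def matrix_mul_assoc)

text \<open>Multiplying the definition of \<open>mu_rel\<close> by \<open>I_rel\<close> and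
  transposing expresses \<open>II_rel\<close> as minus \<open>I_rel\<close> times the transpose of
  \<open>mu_rel\<close>. The factorization of \<open>Df\<close> reduces \<open>form2\<close> to
  \<open>Lambda_rel\<close> times \<open>II_rel\<close>.\<close>

lemma form2_eq:
  assumes "q \<in> U"
  shows "form2 x \<Omega> q = - (Lambda_rel x \<Omega> q ** I_rel \<Omega> q ** transpose (mu_rel \<Omega> q))"
proof -
  have tr: "transpose (- A) = - transpose A" for A :: "real^2^2"
    by (simp add: vec_eq_iff transpose_def)
  have "mu_rel \<Omega> q ** I_rel \<Omega> q = - (transpose (II_rel \<Omega> q) ** (matrix_inv (I_rel \<Omega> q) ** I_rel \<Omega> q))"
    by (simp add: mu_rel_def matrix_mult_minus matrix_mul_assoc)
  then have "transpose (mu_rel \<Omega> q ** I_rel \<Omega> q) = - II_rel \<Omega> q"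
    by (simp add: I_rel_inverse assms tr)
  then have "I_rel \<Omega> q ** transpose (mu_rel \<Omega> q) = - II_rel \<Omega> q"
    by (simp add: matrix_transpose_mul transpose_I_rel)
  moreover have "form2 x \<Omega> q = Lambda_rel x \<Omega> q ** II_rel \<Omega> q"
    unfolding form2_def Df_factor[OF assms] II_rel_def
    by (simp add: matrix_transpose_mul matrix_mult_minus matrix_mul_assoc)
  ultimately show ?thesis
    by (simp add: matrix_mult_minus matrix_mul_assoc[symmetric])
qed

lemma smooth_normal: "smooth_on U (normal \<Omega>)"
  unfolding normal_def[abs_def] Let_def
  by (intro smooth_on_bilinear[OF bounded_bilinear_scaleR] smooth_on_inverse smooth_on_norm
      smooth_on_cross3 smooth_on_column smooth_Omega open_U) (simp_all add: cross_columns_neq_0)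

text \<open>Differentiating the orthogonality of the partial derivatives to the normal turns each
  entry into a second derivative of \<open>x\<close> paired with the normal, and mixed second
  derivatives commute.\<close>

lemma form2_symmetric:
  assumes "q \<in> U"
  shows "form2 x \<Omega> q $ 1 $ 2 = form2 x \<Omega> q $ 2 $ 1"
proof -
  let ?n = "normal \<Omega>"
  define X where "X = (\<lambda>j q. frechet_derivative x (at q) (axis j 1))"
  have entry: "form2 x \<Omega> q $ i $ j = - (X i q \<bullet> frechet_derivative ?n (at q) (axis j 1))" for i j
    by (simp add: form2_def matrix_matrix_mult_def transpose_def jacobian_def matrix_def X_def inner_vec_def)
  have X: "(X i has_derivative frechet_derivative (X i) (at q)) (at q)" for i
    using smooth_on_imp_differentiable[OF smooth_on_frechet_derivative[OF smooth_x] assms]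
    by (simp add: X_def frechet_derivative_works)
  have n: "(?n has_derivative frechet_derivative ?n (at q)) (at q)"
    using smooth_on_imp_differentiable[OF smooth_normal assms] by (simp add: frechet_derivative_works)
  have "X i r \<bullet> ?n r = 0" if "r \<in> U" for i r
  proof -
    have "X i r = column i (Df x r)"
      by (simp add: X_def column_def jacobian_def matrix_def vec_eq_iff)
    then show ?thesis
      using normal_orthogonal_span[OF that, of "X i r"] tmb that exhaust_2[of i]
      unfolding tangent_moving_basis_def Let_def by (auto simp: inner_commute)
  qed
  then have "((\<lambda>r. X i r \<bullet> ?n r) has_derivative (\<lambda>v. 0)) (at q)" for i
    by (intro has_derivative_transform_within_open[OF has_derivative_const open_U assms]) simp
  from has_derivative_unique[OF this has_derivative_inner[OF X n]]
  have "X i q \<bullet> frechet_derivative ?n (at q) v + frechet_derivative (X i) (at q) v \<bullet> ?n q = 0" for i v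
    by (metis add.commute)
  moreover have "frechet_derivative (X 1) (at q) (axis 2 1) = frechet_derivative (X 2) (at q) (axis 1 1)"
    unfolding X_def using smooth_x
    by (intro symmetric_second_derivative_vec[OF open_U assms]) (simp add: smooth_on_def)
  ultimately show ?thesis
    unfolding entry by (metis add_right_cancel)
qed

text \<open>The trace in \<open>mean_curvature_numerator\<close> is -2 times \<open>H_rel\<close>,
  which accounts for the factor 2 and the sign.\<close>

lemma mean_H_numerator:
  assumes "q \<in> U"
  shows "coeff_e x \<Omega> q * coeff_G x q + coeff_g x \<Omega> q * coeff_E x q - 2 * coeff_f x \<Omega> q * coeff_F x q =
    2 * lambda_rel x \<Omega> q * det (I_rel \<Omega> q) * H_rel x \<Omega> q"
  using mean_curvature_numerator[OF transpose_I_rel, of "Lambda_rel x \<Omega> q" q "mu_rel \<Omega> q"]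
    form2_symmetric[OF assms]
  unfolding coeff_e_def coeff_f_def coeff_g_def coeff_E_def coeff_F_def coeff_G_def
    form1_eq[OF assms] form2_eq[OF assms] H_rel_def lambda_rel_def by simp

lemma det_form1:
  assumes "q \<in> U"
  shows "coeff_E x q * coeff_G x q - (coeff_F x q)\<^sup>2 = (lambda_rel x \<Omega> q)\<^sup>2 * det (I_rel \<Omega> q)"
proof -
  have "coeff_E x q * coeff_G x q - (coeff_F x q)\<^sup>2 = det (form1 x q)"
    by (simp add: coeff_E_def coeff_F_def coeff_G_def det_2 power2_eq_square form1_def
        matrix_matrix_mult_def transpose_def mult.commute)
  then show ?thesis
    by (simp add: form1_eq[OF assms] det_mul lambda_rel_def power2_eq_square)
qed

lemma det_form2:
  assumes "q \<in> U"
  shows "coeff_e x \<Omega> q * coeff_g x \<Omega> q - (coeff_f x \<Omega> q)\<^sup>2 =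
    lambda_rel x \<Omega> q * det (I_rel \<Omega> q) * K_rel \<Omega> q"
proof -
  have neg: "det (- A) = det A" for A :: "real^2^2" by (simp add: det_2)
  have "coeff_e x \<Omega> q * coeff_g x \<Omega> q - (coeff_f x \<Omega> q)\<^sup>2 = det (form2 x \<Omega> q)"
    by (simp add: coeff_e_def coeff_f_def coeff_g_def det_2 power2_eq_square form2_symmetric[OF assms])
  then show ?thesis
    by (simp add: form2_eq[OF assms] neg det_mul lambda_rel_def K_rel_def)
qed

text \<open>\<open>\<Omega> q\<close> has a left inverse, so the factor \<open>\<Omega> q\<close> in
  \<open>Df\<close> does not affect injectivity; what remains is a square matrix, injective iff its
  determinant is nonzero.\<close>

lemma singular_set_eq: "singular_set U x = {q \<in> U. lambda_rel x \<Omega> q = 0}"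
proof -
  have "immersive_at x q \<longleftrightarrow> lambda_rel x \<Omega> q \<noteq> 0" if q: "q \<in> U" for q
  proof -
    let ?L = "transpose (Lambda_rel x \<Omega> q)"
    have "x differentiable (at q)" by (rule smooth_on_imp_differentiable[OF smooth_x q])
    then have "frechet_derivative x (at q) = (*v) (Df x q)"
      by (simp add: jacobian_def fun_eq_iff matrix_works linear_frechet_derivative)
    then have "immersive_at x q \<longleftrightarrow> inj ((*v) (\<Omega> q ** ?L))"
      using \<open>x differentiable (at q)\<close> by (simp add: immersive_at_def Df_factor[OF q])
    also have "\<dots> \<longleftrightarrow> inj ((*v) ?L)"
    proof
      assume "inj ((*v) (\<Omega> q ** ?L))"
      then show "inj ((*v) ?L)" by (metis (no_types, lifting) injI inj_eq matrix_vector_mul_assoc)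
    next
      \<comment> \<open>The left inverse of \<open>\<Omega> q\<close> is the inverse Gram matrix
        times the transpose of \<open>\<Omega> q\<close>.\<close>
      have "matrix_inv (I_rel \<Omega> q) ** transpose (\<Omega> q) ** (\<Omega> q ** ?L) = ?L"
        using I_rel_inverse(2)[OF q] by (metis I_rel_def matrix_mul_assoc matrix_mul_lid)
      moreover assume "inj ((*v) ?L)"
      ultimately show "inj ((*v) (\<Omega> q ** ?L))"
        by (metis (no_types, lifting) injI inj_eq matrix_vector_mul_assoc)
    qed
    also have "\<dots> \<longleftrightarrow> det ?L \<noteq> 0"
      by (metis invertible_det_nz invertible_left_inverse matrix_left_invertible_injective)
    finally show ?thesis by (simp add: lambda_rel_def)
  qed
  then show ?thesis unfolding singular_set_def by blast
qed

section \<open>Smoothness of the relative quantities\<close>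

lemma smooth_I: "smooth_on U (I_rel \<Omega>)"
  unfolding I_rel_def[abs_def]
  by (intro smooth_on_matrix_mult smooth_on_transpose smooth_Omega open_U)

lemma smooth_I_inverse: "smooth_on U (\<lambda>q. matrix_inv (I_rel \<Omega> q))"
  by (rule smooth_on_matrix_inv_2[OF open_U smooth_I]) (use det_I_rel_pos in force)

lemma smooth_Lambda: "smooth_on U (Lambda_rel x \<Omega>)"
  unfolding Lambda_rel_def[abs_def]
  by (intro smooth_on_matrix_mult smooth_on_transpose smooth_on_jacobian smooth_x smooth_Omega
      smooth_I_inverse open_U)

lemma smooth_mu: "smooth_on U (mu_rel \<Omega>)"
  unfolding mu_rel_def[abs_def] II_rel_def
  by (intro smooth_on_minus smooth_on_matrix_mult smooth_on_transpose smooth_on_jacobian smooth_normal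
      smooth_Omega smooth_I_inverse open_U)

lemma smooth_lambda: "smooth_on U (lambda_rel x \<Omega>)"
  unfolding lambda_rel_def[abs_def] by (intro smooth_on_det2 smooth_Lambda open_U)

lemma smooth_K: "smooth_on U (K_rel \<Omega>)"
  unfolding K_rel_def[abs_def] by (intro smooth_on_det2 smooth_mu open_U)

lemma smooth_H: "smooth_on U (H_rel x \<Omega>)"
  unfolding H_rel_def[abs_def]
  by (intro smooth_on_mult smooth_on_const smooth_on_trace smooth_on_matrix_mult smooth_on_adj2
      smooth_mu smooth_Lambda open_U)

lemma smooth_det_I: "smooth_on U (\<lambda>q. det (I_rel \<Omega> q))"
  by (intro smooth_on_det2 smooth_I open_U)

end

subsection \<open>Domination up to a constant\<close>

lemma nonvanishing_compact_bounds:
  fixes a :: "'a::topological_space \<Rightarrow> real"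
  assumes "compact W" "continuous_on W a" "\<And>q. q \<in> W \<Longrightarrow> a q \<noteq> 0"
  obtains m M where "m > 0" "M > 0" "\<And>q. q \<in> W \<Longrightarrow> m \<le> \<bar>a q\<bar> \<and> \<bar>a q\<bar> \<le> M"
proof (cases "W = {}")
  case False
  have cont: "continuous_on W (\<lambda>q. \<bar>a q\<bar>)"
    by (intro continuous_intros assms)
  obtain q1 where q1: "q1 \<in> W" "\<And>q. q \<in> W \<Longrightarrow> \<bar>a q1\<bar> \<le> \<bar>a q\<bar>"
    using continuous_attains_inf[OF assms(1) False cont] by blast
  obtain q2 where q2: "q2 \<in> W" "\<And>q. q \<in> W \<Longrightarrow> \<bar>a q\<bar> \<le> \<bar>a q2\<bar>"
    using continuous_attains_sup[OF assms(1) False cont] by blast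
  show ?thesis
    by (rule that[of "\<bar>a q1\<bar>" "\<bar>a q2\<bar>"]) (use q1 q2 assms(3) in auto)
\<comment> \<open>For empty \<open>W\<close> no extrema exist, and any positive constants
  serve.\<close>
qed (use that[of 1 1] in simp)

text \<open>The common shape to which all five statements are reduced. \<open>C\<close> is required
  positive so that (2), (3) and (4) are literally instances.\<close>

definition dominated_on :: "'a set \<Rightarrow> ('a \<Rightarrow> real) \<Rightarrow> ('a \<Rightarrow> real) \<Rightarrow> bool" where
  "dominated_on W f g \<longleftrightarrow> (\<exists>C>0. \<forall>q\<in>W. \<bar>f q\<bar> \<le> C * \<bar>g q\<bar>)"

lemma dominated_on_cong:
  "(\<And>q. q \<in> W \<Longrightarrow> f q = f' q) \<Longrightarrow> (\<And>q. q \<in> W \<Longrightarrow> g q = g' q) \<Longrightarrow>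
     dominated_on W f g \<longleftrightarrow> dominated_on W f' g'"
  by (simp add: dominated_on_def)

text \<open>A continuous nonvanishing factor on a compact set lies between positive bounds
  \<open>m\<close> and \<open>M\<close> in absolute value, so it only changes the constant:
  \<open>C / m\<close> in one direction, \<open>M * C\<close> in the other.\<close>

lemma dominated_on_mult_cancel:
  assumes "compact W" "continuous_on W a" "\<And>q. q \<in> W \<Longrightarrow> a q \<noteq> 0"
  shows "dominated_on W (\<lambda>q. a q * f q) g \<longleftrightarrow> dominated_on W f g"
proof -
  obtain m M where m: "m > 0" and M: "M > 0"
    and bounds: "\<And>q. q \<in> W \<Longrightarrow> m \<le> \<bar>a q\<bar> \<and> \<bar>a q\<bar> \<le> M"
    using nonvanishing_compact_bounds[OF assms] by blast
  show ?thesis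
  proof
    assume "dominated_on W (\<lambda>q. a q * f q) g"
    then obtain C where C: "C > 0" "\<And>q. q \<in> W \<Longrightarrow> \<bar>a q\<bar> * \<bar>f q\<bar> \<le> C * \<bar>g q\<bar>"
      by (auto simp: dominated_on_def abs_mult)
    have "\<bar>f q\<bar> \<le> C / m * \<bar>g q\<bar>" if "q \<in> W" for q
    proof -
      have "m * \<bar>f q\<bar> \<le> C * \<bar>g q\<bar>"
        using mult_right_mono[of m "\<bar>a q\<bar>" "\<bar>f q\<bar>"] bounds[OF that] C(2)[OF that] by linarith
      then show ?thesis using m by (simp add: field_simps)
    qed
    then show "dominated_on W f g"
      unfolding dominated_on_def using C(1) m by (intro exI[of _ "C / m"]) simp
  next
    assume "dominated_on W f g"
    then obtain C where C: "C > 0" "\<And>q. q \<in> W \<Longrightarrow> \<bar>f q\<bar> \<le> C * \<bar>g q\<bar>"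
      by (auto simp: dominated_on_def)
    have "\<bar>a q * f q\<bar> \<le> M * C * \<bar>g q\<bar>" if "q \<in> W" for q
      using mult_mono[of "\<bar>a q\<bar>" M "\<bar>f q\<bar>" "C * \<bar>g q\<bar>"] bounds[OF that] C(2)[OF that] M
      by (simp add: abs_mult mult.assoc)
    then show "dominated_on W (\<lambda>q. a q * f q) g"
      unfolding dominated_on_def using C(1) M by (intro exI[of _ "M * C"]) simp
  qed
qed

text \<open>For a fixed \<open>C\<close> the inequality defines a closed subset of \<open>W\<close>;
  containing \<open>S\<close>, it contains the closure of \<open>S\<close> and hence
  \<open>W\<close>. The constant is unchanged.\<close>

lemma dominated_on_dense:
  fixes f g :: "'a::topological_space \<Rightarrow> real"
  assumes "closed W" "S \<subseteq> W" "W \<subseteq> closure S" "continuous_on W f" "continuous_on W g"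
  shows "dominated_on S f g \<longleftrightarrow> dominated_on W f g"
proof
  assume "dominated_on S f g"
  then obtain C where C: "C > 0" "\<forall>q\<in>S. \<bar>f q\<bar> \<le> C * \<bar>g q\<bar>"
    by (auto simp: dominated_on_def)
  have "closed {q \<in> W. \<bar>f q\<bar> \<le> C * \<bar>g q\<bar>}"
    by (intro continuous_on_closed_Collect_le continuous_intros assms)
  moreover have "S \<subseteq> {q \<in> W. \<bar>f q\<bar> \<le> C * \<bar>g q\<bar>}" using C assms(2) by auto
  ultimately have "W \<subseteq> {q \<in> W. \<bar>f q\<bar> \<le> C * \<bar>g q\<bar>}"
    using closure_minimal assms(3) by blast
  then show "dominated_on W f g" using C by (auto simp: dominated_on_def)
qed (use assms(2) in \<open>auto simp: dominated_on_def\<close>)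

lemma dominated_on_iff_bounded_quotient:
  assumes "\<And>q. q \<in> S \<Longrightarrow> g q \<noteq> 0"
  shows "dominated_on S f g \<longleftrightarrow> bounded ((\<lambda>q. f q / g q) ` S)"
  unfolding dominated_on_def bounded_pos
  by (simp add: abs_divide pos_divide_le_eq assms)

lemma dominated_on_mult_right:
  assumes "\<And>q. q \<in> S \<Longrightarrow> g q \<noteq> 0"
  shows "dominated_on S (\<lambda>q. g q * f q) (\<lambda>q. (g q)\<^sup>2) \<longleftrightarrow> dominated_on S f g"
proof -
  have "\<bar>g q * f q\<bar> \<le> C * \<bar>(g q)\<^sup>2\<bar> \<longleftrightarrow> \<bar>f q\<bar> \<le> C * \<bar>g q\<bar>" if "q \<in> S" for q C
  proof -
    have "C * \<bar>(g q)\<^sup>2\<bar> = \<bar>g q\<bar> * (C * \<bar>g q\<bar>)"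
      by (simp add: power2_eq_square)
    then show ?thesis
      using assms[OF that] by (simp only: abs_mult) simp
  qed
  then show ?thesis by (simp add: dominated_on_def)
qed

subsection \<open>Curvatures off the singular set\<close>

text \<open>The two denominators are the roots of a monic quadratic with root sum
  \<open>2 * H\<close> and root product \<open>K\<close>.\<close>

lemma reciprocal_root_sum:
  fixes H K :: real
  assumes "K \<le> H\<^sup>2" "K \<noteq> 0"
  shows "1 / (H - sqrt (H\<^sup>2 - K)) + 1 / (H + sqrt (H\<^sup>2 - K)) = 2 * H / K"
proof -
  have "(H - sqrt (H\<^sup>2 - K)) * (H + sqrt (H\<^sup>2 - K)) = H\<^sup>2 - (sqrt (H\<^sup>2 - K))\<^sup>2"
    by (simp add: algebra_simps power2_eq_square)
  also have "\<dots> = K" using assms(1) by simp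
  finally have prod: "(H - sqrt (H\<^sup>2 - K)) * (H + sqrt (H\<^sup>2 - K)) = K" .
  then have "H - sqrt (H\<^sup>2 - K) \<noteq> 0" "H + sqrt (H\<^sup>2 - K) \<noteq> 0" using assms(2) by auto
  then show ?thesis by (simp add: add_frac_eq prod)
qed

context moving_basis
begin

lemma
  assumes "q \<in> U - singular_set U x"
  shows mean_H_eq: "mean_H x \<Omega> q = H_rel x \<Omega> q / lambda_rel x \<Omega> q"
    and gauss_K_eq: "gauss_K x \<Omega> q = K_rel \<Omega> q / lambda_rel x \<Omega> q"
    and gauss_K_le: "gauss_K x \<Omega> q \<le> (mean_H x \<Omega> q)\<^sup>2"
proof -
  have q: "q \<in> U" and l: "lambda_rel x \<Omega> q \<noteq> 0"
    using assms by (auto simp: singular_set_eq)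
  note d = det_I_rel_pos[OF q]
  show "mean_H x \<Omega> q = H_rel x \<Omega> q / lambda_rel x \<Omega> q"
    unfolding mean_H_def mean_H_numerator[OF q] det_form1[OF q]
    using l d by (simp add: power2_eq_square)
  show "gauss_K x \<Omega> q = K_rel \<Omega> q / lambda_rel x \<Omega> q"
    unfolding gauss_K_def det_form2[OF q] det_form1[OF q]
    using l d by (simp add: power2_eq_square)
  let ?D = "coeff_E x q * coeff_G x q - (coeff_F x q)\<^sup>2"
  have D: "?D > 0" unfolding det_form1[OF q] using l d by simp
  have "coeff_E x q \<ge> 0"
    by (simp add: coeff_E_def form1_def matrix_matrix_mult_def transpose_def sum_nonneg)
  \<comment> \<open>If \<open>E\<close> vanished, \<open>?D\<close> would be minus a square.\<close>
  moreover have "coeff_E x q \<noteq> 0" using D by auto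
  ultimately have "coeff_E x q > 0" by simp
  from principal_curvature_discriminant[OF this D]
  show "gauss_K x \<Omega> q \<le> (mean_H x \<Omega> q)\<^sup>2"
    by (simp only: gauss_K_def mean_H_def)
qed

text \<open>The sign of \<open>lambda_rel\<close> only decides which root is called
  \<open>k1\<close>, so the sum is the same in both cases; in the quotient of \<open>H\<close> by
  \<open>K\<close> the factor \<open>lambda_rel\<close> cancels.\<close>

lemma recip_sum:
  assumes "q \<in> U - singular_set U x" "K_rel \<Omega> q \<noteq> 0"
  shows "1 / k1 x \<Omega> q + 1 / k2 x \<Omega> q = 2 / K_rel \<Omega> q * H_rel x \<Omega> q"
proof -
  have l: "lambda_rel x \<Omega> q \<noteq> 0" using assms(1) by (simp add: singular_set_eq)
  have "gauss_K x \<Omega> q \<noteq> 0" using assms(2) l by (simp add: gauss_K_eq[OF assms(1)])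
  then have "1 / k1 x \<Omega> q + 1 / k2 x \<Omega> q = 2 * mean_H x \<Omega> q / gauss_K x \<Omega> q"
    using reciprocal_root_sum[OF gauss_K_le[OF assms(1)]] by (simp add: k1_def k2_def add.commute)
  then show ?thesis using l by (simp add: mean_H_eq[OF assms(1)] gauss_K_eq[OF assms(1)])
qed

lemma recip_sum_rel:
  assumes "q \<in> U - singular_set U x" "K_rel \<Omega> q \<noteq> 0"
  shows "1 / k1_rel x \<Omega> q + 1 / k2_rel x \<Omega> q =
    2 / K_rel \<Omega> q * H_rel x \<Omega> q / lambda_rel x \<Omega> q"
proof -
  have l: "lambda_rel x \<Omega> q \<noteq> 0" using assms(1) by (simp add: singular_set_eq)
  \<comment> \<open>The relative discriminant is the square of \<open>lambda_rel\<close> times the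
    ordinary one, hence inherits nonnegativity.\<close>
  have "(lambda_rel x \<Omega> q)\<^sup>2 * gauss_K x \<Omega> q \<le> (lambda_rel x \<Omega> q)\<^sup>2 * (mean_H x \<Omega> q)\<^sup>2"
    by (intro mult_left_mono gauss_K_le[OF assms(1)]) simp
  then have "lambda_rel x \<Omega> q * K_rel \<Omega> q \<le> (H_rel x \<Omega> q)\<^sup>2"
    using l by (simp add: mean_H_eq[OF assms(1)] gauss_K_eq[OF assms(1)] power2_eq_square)
  from reciprocal_root_sum[OF this] show ?thesis
    using l assms(2) by (simp add: k1_rel_def k2_rel_def mult.commute)
qed

lemma smooth_recip_sum:
  "smooth_on {q \<in> U. K_rel \<Omega> q \<noteq> 0} (\<lambda>q. 2 / K_rel \<Omega> q * H_rel x \<Omega> q)"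
proof -
  let ?V = "{q \<in> U. K_rel \<Omega> q \<noteq> 0}"
  have "open (U \<inter> K_rel \<Omega> -` (- {0}))"
    using continuous_open_preimage[OF smooth_on_imp_continuous_on[OF smooth_K] open_U] by blast
  also have "U \<inter> K_rel \<Omega> -` (- {0}) = ?V" by auto
  finally have V: "open ?V" .
  have "?V \<subseteq> U" by auto
  then show ?thesis
    unfolding divide_inverse
    by (intro smooth_on_mult smooth_on_const smooth_on_inverse V smooth_on_subset[OF smooth_K]
        smooth_on_subset[OF smooth_H]) auto
qed

text \<open>The function \<open>2 / K_rel * H_rel\<close> witnesses that a smooth extension exists,
  so the chosen one has the defining properties. The formula is recorded at nonsingular points;
  density carries estimates across the singular set.\<close>

lemma recip_sum_ext:
  "smooth_on {q \<in> U. K_rel \<Omega> q \<noteq> 0} (recip_sum_ext U x \<Omega>)"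
  "q \<in> U - singular_set U x \<Longrightarrow> K_rel \<Omega> q \<noteq> 0 \<Longrightarrow>
     recip_sum_ext U x \<Omega> q = 2 / K_rel \<Omega> q * H_rel x \<Omega> q"
proof -
  let ?P = "\<lambda>\<phi>. smooth_on {q\<in>U. K_rel \<Omega> q \<noteq> 0} \<phi> \<and>
    (\<forall>q\<in>{q\<in>U. K_rel \<Omega> q \<noteq> 0} - singular_set U x. \<phi> q = 1 / k1 x \<Omega> q + 1 / k2 x \<Omega> q)"
  have "?P (\<lambda>q. 2 / K_rel \<Omega> q * H_rel x \<Omega> q)"
    using smooth_recip_sum by (auto simp: recip_sum)
  then have P: "?P (recip_sum_ext U x \<Omega>)"
    unfolding recip_sum_ext_def by (rule someI[of ?P])
  show "smooth_on {q \<in> U. K_rel \<Omega> q \<noteq> 0} (recip_sum_ext U x \<Omega>)"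
    using P by blast
  show "recip_sum_ext U x \<Omega> q = 2 / K_rel \<Omega> q * H_rel x \<Omega> q"
    if "q \<in> U - singular_set U x" "K_rel \<Omega> q \<noteq> 0"
    using P that recip_sum[OF that] by auto
qed

end

text \<open>Whatever part of the interior of \<open>W\<close> avoided the closure of the nonsingular
  points would be an open subset of \<Sigma>, hence empty. The regularity of \<open>W\<close>
  extends this from its interior to all of \<open>W\<close>.\<close>

lemma nonsingular_dense:
  assumes "interior \<Sigma> = {}" "closure (interior W) = W"
  shows "W \<subseteq> closure (W - \<Sigma>)"
proof -
  have "interior W \<subseteq> closure (interior W - \<Sigma>)"
  proof
    fix q assume q: "q \<in> interior W"
    show "q \<in> closure (interior W - \<Sigma>)"
    proof (rule ccontr)
      assume "q \<notin> closure (interior W - \<Sigma>)"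
      then have "q \<in> interior W - closure (interior W - \<Sigma>)" using q by blast
      moreover have "interior W - closure (interior W - \<Sigma>) \<subseteq> interior \<Sigma>"
        using closure_subset[of "interior W - \<Sigma>"] by (intro interior_maximal open_Diff) auto
      ultimately show False using assms(1) by blast
    qed
  qed
  also have "\<dots> \<subseteq> closure (W - \<Sigma>)"
    using interior_subset[of W] by (intro closure_mono) auto
  finally show ?thesis
    using closure_minimal[of "interior W"] assms(2) by auto
qed

theorem proposition5p3:
  fixes U W :: "(real^2) set" and x :: "real^2 \<Rightarrow> real^3" and \<Omega> :: "real^2 \<Rightarrow> real^2^3"
    and p :: "real^2"
  assumes "open U"
    and "wavefront U x" and "proper U x"
    and "tangent_moving_basis U x \<Omega>"
    and "p \<in> singular_set U x" and "rank (Df x p) = 0"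
    and "compact_nbhd p W" and "W \<subseteq> U"
    and "\<forall>q\<in>W. K_rel \<Omega> q \<noteq> 0"
  shows
    "let S1 = bounded (mean_H x \<Omega> ` (W - singular_set U x));
         S2 = (\<exists>C>0. \<forall>q\<in>W. \<bar>H_rel x \<Omega> q\<bar> \<le> C * \<bar>lambda_rel x \<Omega> q\<bar>);
         S3 = (\<exists>C>0. \<forall>q\<in>W.
                 \<bar>coeff_e x \<Omega> q * coeff_G x q + coeff_g x \<Omega> q * coeff_E x q
                    - 2 * coeff_f x \<Omega> q * coeff_F x q\<bar> \<le> C * \<bar>(lambda_rel x \<Omega> q)\<^sup>2\<bar>);
         S4 = (\<exists>C>0. \<forall>q\<in>W. \<bar>recip_sum_ext U x \<Omega> q\<bar> \<le> C * \<bar>lambda_rel x \<Omega> q\<bar>);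
         S5 = bounded ((\<lambda>q. 1 / k1_rel x \<Omega> q + 1 / k2_rel x \<Omega> q) ` (W - singular_set U x))
     in (S1 \<longleftrightarrow> S2) \<and> (S2 \<longleftrightarrow> S3) \<and> (S3 \<longleftrightarrow> S4) \<and> (S4 \<longleftrightarrow> S5)"
proof -
  interpret moving_basis U x \<Omega>
    using assms(1,2,4) by unfold_locales (auto simp: wavefront_def frontal_def)
  let ?h = "H_rel x \<Omega>" and ?l = "lambda_rel x \<Omega>" and ?k = "K_rel \<Omega>" and ?d = "\<lambda>q. det (I_rel \<Omega> q)"
  let ?S = "W - singular_set U x"
  have W: "compact W" "closed W" "closure (interior W) = W"
    using assms(7) by (auto simp: compact_nbhd_def compact_imp_closed)
  have dense: "W \<subseteq> closure ?S"
    using nonsingular_dense[OF _ W(3)] assms(3) by (simp add: proper_def)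
  have regular: "q \<in> U - singular_set U x" "?l q \<noteq> 0" if "q \<in> ?S" for q
    using that \<open>W \<subseteq> U\<close> by (auto simp: singular_set_eq)
  have k: "?k q \<noteq> 0" if "q \<in> W" for q using assms(9) that by blast
  have d: "2 * ?d q \<noteq> 0" if "q \<in> W" for q
    using det_I_rel_pos[of q] \<open>W \<subseteq> U\<close> that by auto
  have cont: "continuous_on W ?h" "continuous_on W ?l" "continuous_on W ?k" "continuous_on W ?d"
    using smooth_H smooth_lambda smooth_K smooth_det_I
    by (auto intro: continuous_on_subset[OF smooth_on_imp_continuous_on \<open>W \<subseteq> U\<close>])
  have cont_recip: "continuous_on W (\<lambda>q. 2 / ?k q)"
    by (intro continuous_intros cont) (simp add: k)
  have dense_iff: "dominated_on ?S f g \<longleftrightarrow> dominated_on W f g"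
    if "continuous_on W f" "continuous_on W g" for f g
    by (rule dominated_on_dense[OF W(2) _ dense that]) auto

  have "bounded (mean_H x \<Omega> ` ?S) \<longleftrightarrow> bounded ((\<lambda>q. ?h q / ?l q) ` ?S)"
    by (intro arg_cong[of _ _ bounded] image_cong refl mean_H_eq regular)
  also have "\<dots> \<longleftrightarrow> dominated_on ?S ?h ?l"
    by (rule dominated_on_iff_bounded_quotient[symmetric]) (rule regular)
  also have "\<dots> \<longleftrightarrow> dominated_on W ?h ?l"
    by (rule dense_iff[OF cont(1,2)])
  finally have S1: "bounded (mean_H x \<Omega> ` ?S) \<longleftrightarrow> dominated_on W ?h ?l" .

  \<comment> \<open>For (3) a factor \<open>?l\<close> must be cancelled, which is possible only
    where it is nonzero: pass to \<open>?S\<close> by density, cancel, return to \<open>W\<close>,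
    and then remove the nonvanishing factor \<open>2 * ?d\<close> by compactness.\<close>
  have cont_num: "continuous_on W (\<lambda>q. 2 * ?d q * ?h q)" "continuous_on W (\<lambda>q. (?l q)\<^sup>2)"
    by (intro continuous_intros cont)+
  have "dominated_on W (\<lambda>q. coeff_e x \<Omega> q * coeff_G x q + coeff_g x \<Omega> q * coeff_E x q
      - 2 * coeff_f x \<Omega> q * coeff_F x q) (\<lambda>q. (?l q)\<^sup>2) \<longleftrightarrow>
    dominated_on W (\<lambda>q. ?l q * (2 * ?d q * ?h q)) (\<lambda>q. (?l q)\<^sup>2)"
    using \<open>W \<subseteq> U\<close> by (intro dominated_on_cong) (auto simp: mean_H_numerator)
  also have "\<dots> \<longleftrightarrow> dominated_on ?S (\<lambda>q. ?l q * (2 * ?d q * ?h q)) (\<lambda>q. (?l q)\<^sup>2)"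
    by (intro dense_iff[symmetric] continuous_on_mult cont_num cont)
  also have "\<dots> \<longleftrightarrow> dominated_on ?S (\<lambda>q. 2 * ?d q * ?h q) ?l"
    by (rule dominated_on_mult_right) (rule regular)
  also have "\<dots> \<longleftrightarrow> dominated_on W (\<lambda>q. 2 * ?d q * ?h q) ?l"
    by (rule dense_iff[OF cont_num(1) cont(2)])
  also have "\<dots> \<longleftrightarrow> dominated_on W ?h ?l"
    by (rule dominated_on_mult_cancel[OF W(1) _ d]) (intro continuous_intros cont)
  finally have S3: "dominated_on W (\<lambda>q. coeff_e x \<Omega> q * coeff_G x q + coeff_g x \<Omega> q * coeff_E x q
      - 2 * coeff_f x \<Omega> q * coeff_F x q) (\<lambda>q. (?l q)\<^sup>2) \<longleftrightarrow> dominated_on W ?h ?l" .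

  have recip: "dominated_on W (\<lambda>q. 2 / ?k q * ?h q) ?l \<longleftrightarrow> dominated_on W ?h ?l"
    by (rule dominated_on_mult_cancel[OF W(1) cont_recip]) (simp add: k)

  \<comment> \<open>For (4) the chosen extension is continuous on \<open>W\<close> but has its
    formula only on \<open>?S\<close>, so the comparison takes place there.\<close>
  have "W \<subseteq> {q \<in> U. ?k q \<noteq> 0}" using k \<open>W \<subseteq> U\<close> by auto
  then have "continuous_on W (recip_sum_ext U x \<Omega>)"
    using recip_sum_ext(1) smooth_on_imp_continuous_on continuous_on_subset by blast
  then have "dominated_on W (recip_sum_ext U x \<Omega>) ?l \<longleftrightarrow> dominated_on ?S (recip_sum_ext U x \<Omega>) ?l"
    by (rule dense_iff[symmetric, OF _ cont(2)])
  also have "\<dots> \<longleftrightarrow> dominated_on ?S (\<lambda>q. 2 / ?k q * ?h q) ?l"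
    by (intro dominated_on_cong recip_sum_ext(2) regular k refl) auto
  \<comment> \<open>Named because the equivalence for (5) ends with the same link.\<close>
  also have off: "\<dots> \<longleftrightarrow> dominated_on W ?h ?l"
    unfolding recip[symmetric] by (intro dense_iff continuous_on_mult cont_recip cont)
  finally have S4: "dominated_on W (recip_sum_ext U x \<Omega>) ?l \<longleftrightarrow> dominated_on W ?h ?l" .

  have "bounded ((\<lambda>q. 1 / k1_rel x \<Omega> q + 1 / k2_rel x \<Omega> q) ` ?S) \<longleftrightarrow>
      bounded ((\<lambda>q. 2 / ?k q * ?h q / ?l q) ` ?S)"
    by (intro arg_cong[of _ _ bounded] image_cong refl recip_sum_rel regular k) auto
  also have "\<dots> \<longleftrightarrow> dominated_on ?S (\<lambda>q. 2 / ?k q * ?h q) ?l"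
    by (rule dominated_on_iff_bounded_quotient[symmetric]) (rule regular)
  also note off
  finally have S5: "bounded ((\<lambda>q. 1 / k1_rel x \<Omega> q + 1 / k2_rel x \<Omega> q) ` ?S) \<longleftrightarrow>
      dominated_on W ?h ?l" .

  \<comment> \<open>Statement (2) is the domination of \<open>?h\<close> by \<open>?l\<close>
    itself, so equivalence of each other statement with it suffices.\<close>
  show ?thesis
    using S1 S3 S4 S5 unfolding Let_def dominated_on_def by blast
qed

end
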